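(* Let $k\ge1$ be an integer, $0\le\alpha<1$, $0<r<1$, and $f\in S^{k*}_{LH}(\alpha)$. Let $Ar$ denote the area of the image $f(\mathbb{D}_r)$ of the disk $\mathbb{D}_r=\{z\in\mathbb{C}:|z|<r\}$. Then $$2\pi L_1\le Ar\le 2\pi L_2,$$ where $$L_{1}=\int_{0}^{r}\left(\frac{1-(1-2\alpha)\rho^{k}}{(1+\rho^{k})^{\frac{2(\alpha+k)}{k}}}\right)^{2}\exp\left(\frac{-8(1-\alpha)\rho^{k}}{k(1+\rho^{k})}\right)\rho\, d\rho-\int_{0}^{r}\left(\frac{\rho^k(1+(1-2\alpha)\rho^{k})}{(1-\rho^{k})^{\frac{2(\alpha+k)}{k}}}\right)^{2}\exp\left(\frac{8(1-\alpha)\rho^{k}}{k(1-\rho^{k})}\right)\rho\, d\rho$$ and $$L_{2}=\int_{0}^{r}\left(\frac{1+(1-2\alpha)\rho^{k}}{(1-\rho^{k})^{\frac{2(\alpha+k)}{k}}}\right)^{2}\exp\left(\frac{8(1-\alpha)\rho^{k}}{k(1-\rho^{k})}\right)\rho\, d\rho-\int_{0}^{r}\left(\frac{\rho^k(1-(1-2\alpha)\rho^{k})}{(1+\rho^{k})^{\frac{2(\alpha+k)}{k}}}\right)^{2}\exp\left(\frac{-8(1-\alpha)\rho^{k}}{k(1+\rho^{k})}\right)\rho\, d\rho.$$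
   Context: $\mathbb{D}=\{z\in\mathbb{C}:|z|<1\}$. A mapping $f$ on $\mathbb{D}$ is logharmonic if it solves $\overline{f_{\overline z}}/\overline{f}=\omega\, f_z/f$ for some analytic $\omega:\mathbb{D}\to\mathbb{C}$ with $|\omega|<1$, called the second dilatation of $f$. A mapping $f$ is $k$-fold symmetric if $f(e^{2\pi i/k}z)=e^{2\pi i/k}f(z)$. For an integer $k\ge1$ and $0\le\alpha<1$, $S^{k*}_{LH}(\alpha)$ is the class of univalent $k$-fold symmetric logharmonic mappings on $\mathbb{D}$ of the form $f(z)=zh(z)\overline{g(z)}$ with $h(z)=\exp\left(\sum_{n\ge1}a_{nk}z^{nk}\right)$ and $g(z)=\exp\left(\sum_{n\ge1}b_{nk}z^{nk}\right)$ analytic in $\mathbb{D}$, that are starlike of order $\alpha$: $\operatorname{Re}\left(\frac{zf_z(z)-\overline z f_{\overline z}(z)}{f(z)}\right)>\alpha$ for all $z\in\mathbb{D}$ (understood by its limit at $z=0$). *)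

theory Defs
  imports "HOL-Analysis.Analysis"
begin

abbreviation unit_disc :: "complex set" where
  "unit_disc \<equiv> ball 0 1"

(* Wirtinger derivatives (f_x - i f_y)/2 and (f_x + i f_y)/2; the partial derivatives f_x and f_y
   are the values of the real Frechet derivative in the directions 1 and i. *)
definition wirtinger_dz :: "(complex \<Rightarrow> complex) \<Rightarrow> complex \<Rightarrow> complex" where
  "wirtinger_dz f z =
     (frechet_derivative f (at z) 1 - \<i> * frechet_derivative f (at z) \<i>) / 2"

definition wirtinger_dzbar :: "(complex \<Rightarrow> complex) \<Rightarrow> complex \<Rightarrow> complex" where
  "wirtinger_dzbar f z =
     (frechet_derivative f (at z) 1 + \<i> * frechet_derivative f (at z) \<i>) / 2"

(* The equation has f in its denominators, so it is required where f does not vanish;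
   at a zero of f the equation with denominators cleared holds trivially. *)
definition second_dilatation :: "(complex \<Rightarrow> complex) \<Rightarrow> (complex \<Rightarrow> complex) \<Rightarrow> bool" where
  "second_dilatation f \<omega> \<longleftrightarrow>
     \<omega> analytic_on unit_disc \<and>
     (\<forall>z\<in>unit_disc. norm (\<omega> z) < 1) \<and>
     (\<forall>z\<in>unit_disc. f z \<noteq> 0 \<longrightarrow>
        cnj (wirtinger_dzbar f z) / cnj (f z) = \<omega> z * (wirtinger_dz f z / f z))"

(* Differentiability is over the reals. *)
definition logharmonic :: "(complex \<Rightarrow> complex) \<Rightarrow> bool" where
  "logharmonic f \<longleftrightarrow>
     (\<forall>z\<in>unit_disc. f differentiable (at z)) \<and> (\<exists>\<omega>. second_dilatation f \<omega>)"

definition fold_symmetric :: "nat \<Rightarrow> (complex \<Rightarrow> complex) \<Rightarrow> bool" where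
  "fold_symmetric k f \<longleftrightarrow>
     (\<forall>z\<in>unit_disc. f (exp (2 * of_real pi * \<i> / of_nat k) * z) =
                     exp (2 * of_real pi * \<i> / of_nat k) * f z)"

(* The sum over n \<ge> 1 is shifted to start at 0. *)
definition exp_gap_series :: "nat \<Rightarrow> (nat \<Rightarrow> complex) \<Rightarrow> (complex \<Rightarrow> complex) \<Rightarrow> bool" where
  "exp_gap_series k a h \<longleftrightarrow>
     h analytic_on unit_disc \<and>
     (\<forall>z\<in>unit_disc. summable (\<lambda>n. a (Suc n * k) * z ^ (Suc n * k)) \<and>
                     h z = exp (\<Sum>n. a (Suc n * k) * z ^ (Suc n * k)))"

definition starlike_quotient :: "(complex \<Rightarrow> complex) \<Rightarrow> complex \<Rightarrow> complex" where
  "starlike_quotient f z = (z * wirtinger_dz f z - cnj z * wirtinger_dzbar f z) / f z"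

(* At z = 0, where the quotient is 0/0 for the mappings of interest, it is replaced by its limit. *)
definition starlike_of_order :: "real \<Rightarrow> (complex \<Rightarrow> complex) \<Rightarrow> bool" where
  "starlike_of_order \<alpha> f \<longleftrightarrow>
     (\<forall>z\<in>unit_disc - {0}. Re (starlike_quotient f z) > \<alpha>) \<and>
     (\<exists>L. (starlike_quotient f \<longlongrightarrow> L) (at 0) \<and> Re L > \<alpha>)"

definition S_LH_star :: "nat \<Rightarrow> real \<Rightarrow> (complex \<Rightarrow> complex) set" where
  "S_LH_star k \<alpha> =
     {f. logharmonic f \<and> inj_on f unit_disc \<and> fold_symmetric k f \<and>
         (\<exists>h g a b. exp_gap_series k a h \<and> exp_gap_series k b g \<and>
                    (\<forall>z\<in>unit_disc. f z = z * h z * cnj (g z))) \<and>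
         starlike_of_order \<alpha> f}"

definition L1 :: "nat \<Rightarrow> real \<Rightarrow> real \<Rightarrow> real" where
  "L1 k \<alpha> r =
     integral {0..r} (\<lambda>\<rho>.
       ((1 - (1 - 2 * \<alpha>) * \<rho> ^ k) / (1 + \<rho> ^ k) powr (2 * (\<alpha> + real k) / real k))\<^sup>2
       * exp (- 8 * (1 - \<alpha>) * \<rho> ^ k / (real k * (1 + \<rho> ^ k))) * \<rho>)
     - integral {0..r} (\<lambda>\<rho>.
       (\<rho> ^ k * (1 + (1 - 2 * \<alpha>) * \<rho> ^ k) / (1 - \<rho> ^ k) powr (2 * (\<alpha> + real k) / real k))\<^sup>2
       * exp (8 * (1 - \<alpha>) * \<rho> ^ k / (real k * (1 - \<rho> ^ k))) * \<rho>)"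

definition L2 :: "nat \<Rightarrow> real \<Rightarrow> real \<Rightarrow> real" where
  "L2 k \<alpha> r =
     integral {0..r} (\<lambda>\<rho>.
       ((1 + (1 - 2 * \<alpha>) * \<rho> ^ k) / (1 - \<rho> ^ k) powr (2 * (\<alpha> + real k) / real k))\<^sup>2
       * exp (8 * (1 - \<alpha>) * \<rho> ^ k / (real k * (1 - \<rho> ^ k))) * \<rho>)
     - integral {0..r} (\<lambda>\<rho>.
       (\<rho> ^ k * (1 - (1 - 2 * \<alpha>) * \<rho> ^ k) / (1 + \<rho> ^ k) powr (2 * (\<alpha> + real k) / real k))\<^sup>2
       * exp (- 8 * (1 - \<alpha>) * \<rho> ^ k / (real k * (1 + \<rho> ^ k))) * \<rho>)"

end

theory Submission
  imports Defs "HOL-Complex_Analysis.Conformal_Mappings"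
begin

text \<open>
  Write \<open>h z = exp (Wa (z^k))\<close>, \<open>g z = exp (Wb (z^k))\<close> and, with \<open>w = z^k\<close>,
  \<open>A = 1 + z h'/h\<close> and \<open>B = z g'/g\<close> as functions of w.  The Jacobian of f is
  \<open>|h g|\<^sup>2 (|A|\<^sup>2 - |B|\<^sup>2)\<close>.  Starlikeness says \<open>Re (A - B) > \<alpha>\<close>, and the dilatation
  condition says \<open>|B| < |A|\<close>, so that \<open>p = A - B\<close> (after normalisation) and
  \<open>q = (A + B) / (A - B)\<close> are both Caratheodory functions, and Schwarz's lemma confines them to
  explicit discs.  Since \<open>|A|\<^sup>2 - |B|\<^sup>2 = |p|\<^sup>2 Re q\<close>, and the logarithmic derivative of
  \<open>|h g|\<close> along a ray is \<open>Re (p q - 1)\<close> up to a factor, the Jacobian is bounded pointwise.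
  The pointwise lower bound \<open>G - t\<^sup>2 F\<close> with \<open>t = |w|\<close> leaves enough room that a lower bound for
  \<open>|h g|\<close> with a third-order error in t suffices, which avoids the sharp distortion theorem.
  Integrating in polar coordinates gives the area.
\<close>

subsection \<open>Area of an image in polar coordinates\<close>

text \<open>The change of variables formula applied below measures distortion by the determinant of
  a matrix, so the plane is carried to \<open>real^2\<close> and back.\<close>

definition complex_of_vec2 :: "real^2 \<Rightarrow> complex" where
  "complex_of_vec2 v = Complex (v $ 1) (v $ 2)"

definition vec2_of_complex :: "complex \<Rightarrow> real^2" where
  "vec2_of_complex z = vector [Re z, Im z]"

lemma vec2_of_complex_nth [simp]:
  "vec2_of_complex z $ 1 = Re z" "vec2_of_complex z $ 2 = Im z"
  by (simp_all add: vec2_of_complex_def)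

lemma complex_of_vec2_inverse [simp]: "vec2_of_complex (complex_of_vec2 v) = v"
  by (simp add: complex_of_vec2_def vec_eq_iff forall_2)

lemma vec2_of_complex_inverse [simp]: "complex_of_vec2 (vec2_of_complex z) = z"
  by (simp add: complex_of_vec2_def)

lemma vec2_of_complex_image: "vec2_of_complex ` S = complex_of_vec2 -` S"
proof -
  have "v \<in> vec2_of_complex ` S" if "complex_of_vec2 v \<in> S" for v
    using that by (intro image_eqI[of _ _ "complex_of_vec2 v"]) auto
  then show ?thesis by auto
qed

lemma bounded_linear_vec2_of_complex: "bounded_linear vec2_of_complex"
  by (rule linear_conv_bounded_linear[THEN iffD1], rule linearI)
     (auto simp: vec_eq_iff forall_2)

lemma bounded_linear_complex_of_vec2: "bounded_linear complex_of_vec2"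
  by (rule linear_conv_bounded_linear[THEN iffD1], rule linearI)
     (auto simp: complex_eq_iff complex_of_vec2_def)

text \<open>Lebesgue measure is determined by its values on boxes, and the preimage of a box is the
  box with the same corners in vector coordinates.\<close>

lemma distr_lborel_complex_of_vec2: "distr lborel borel complex_of_vec2 = lborel"
proof (rule lborel_eqI[symmetric])
  fix l u :: complex assume le: "\<And>b. b \<in> Basis \<Longrightarrow> l \<bullet> b \<le> u \<bullet> b"
  have le': "(vec2_of_complex l) \<bullet> b \<le> (vec2_of_complex u) \<bullet> b" if "b \<in> Basis" for b
    using that le[of 1] le[of \<i>]
    by (auto simp: Basis_vec_def UNIV_2 inner_axis Basis_complex_def)
  have m: "complex_of_vec2 \<in> borel_measurable lborel"
    using bounded_linear.continuous_on[OF bounded_linear_complex_of_vec2 continuous_on_id]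
    by (simp add: borel_measurable_continuous_onI)
  have "complex_of_vec2 -` box l u = box (vec2_of_complex l) (vec2_of_complex u)"
    by (auto simp: mem_box_cart forall_2 in_box_complex_iff complex_of_vec2_def)
  then show "emeasure (distr lborel borel complex_of_vec2) (box l u) = (\<Prod>b\<in>Basis. (u - l) \<bullet> b)"
    using m le' by (simp add: emeasure_distr emeasure_lborel_box)
      (simp add: Basis_vec_def UNIV_2 inner_axis Basis_complex_def inner_diff_left axis_eq_axis
         mult.commute)
qed simp

lemma measure_vec2_of_complex_image:
  assumes "S \<in> sets borel"
  shows "measure lebesgue (vec2_of_complex ` S) = measure lebesgue S"
proof -
  have m: "complex_of_vec2 \<in> borel_measurable lborel"
    using bounded_linear.continuous_on[OF bounded_linear_complex_of_vec2 continuous_on_id]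
    by (simp add: borel_measurable_continuous_onI)
  have b: "vec2_of_complex ` S \<in> sets borel"
    using measurable_sets[OF m, of S] assms by (simp add: vec2_of_complex_image)
  have "measure lborel S = measure lborel (complex_of_vec2 -` S)"
    using assms m by (subst distr_lborel_complex_of_vec2[symmetric]) (simp add: measure_distr)
  then show ?thesis using assms b by (simp add: vec2_of_complex_image)
qed

text \<open>Fubini on pairs of reals, transported to \<open>real^2\<close> along the
  measure-preserving coordinate map. The first coordinate will be the radius, the second the
  angle.\<close>

lemma has_integral_cbox_vec2_fst:
  fixes \<psi> :: "real \<Rightarrow> real"
  assumes cont: "continuous_on {a..b} \<psi>" and "c \<le> d"
  shows "((\<lambda>v::real^2. \<psi> (v $ 1)) has_integral ((d - c) * integral {a..b} \<psi>))
           (cbox (vector [a, c]) (vector [b, d]))"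
proof -
  let ?g = "\<lambda>v::real^2. (v $ 1, v $ 2)"
  let ?h = "\<lambda>p::real \<times> real. (vector [fst p, snd p] :: real^2)"
  have c: "continuous_on (cbox (a, c) (b, d)) (\<lambda>p. \<psi> (fst p))"
    by (intro continuous_on_compose2[OF cont] continuous_intros) auto
  have "integral (cbox (a, c) (b, d)) (\<lambda>p. \<psi> (fst p)) = (d - c) * integral {a..b} \<psi>"
    using \<open>c \<le> d\<close> by (simp add: integral_prod_continuous[OF c])
  then have i: "((\<lambda>p. \<psi> (fst p)) has_integral (d - c) * integral {a..b} \<psi>) (cbox (a, c) (b, d))"
    using integrable_continuous[OF c] by (metis has_integral_integral)
  have gi: "?g ` cbox u v = cbox (u $ 1, u $ 2) (v $ 1, v $ 2)" for u v
  proof -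
    have "p \<in> ?g ` cbox u v" if "p \<in> cbox (u $ 1, u $ 2) (v $ 1, v $ 2)" for p
      using that by (cases p, intro image_eqI[of _ _ "?h p"]) (auto simp: mem_box_cart forall_2)
    then show ?thesis by (auto simp: mem_box_cart forall_2)
  qed
  have hi: "?h ` cbox (u1, u2) (v1, v2) = cbox (vector [u1, u2]) (vector [v1, v2])" for u1 u2 v1 v2
  proof -
    have "p \<in> ?h ` cbox (u1, u2) (v1, v2)" if "p \<in> cbox (vector [u1, u2]) (vector [v1, v2])" for p
      using that by (intro image_eqI[of _ _ "?g p"]) (auto simp: mem_box_cart forall_2 vec_eq_iff)
    then show ?thesis by (auto simp: mem_box_cart forall_2)
  qed
  have "((\<lambda>v. \<psi> (fst (?g v))) has_integral (1 / 1) *\<^sub>R ((d - c) * integral {a..b} \<psi>)) (?h ` cbox (a, c) (b, d))"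
  proof (rule has_integral_twiddle[OF _ _ _ _ _ _ _ i])
    show "isCont ?g x" for x
      by (intro continuous_intros)
    have ex2: "(\<exists>i::2. R i) \<longleftrightarrow> R 1 \<or> R 2" for R by (metis exhaust_2)
    show "measure lborel (?g ` cbox u v) = 1 * measure lborel (cbox u v)" for u v
      unfolding gi content_Pair
      by (auto simp: content_cbox_if_cart interval_eq_empty_cart ex2 UNIV_2 content_real_if)
    show "\<exists>w z. ?h ` cbox u v = cbox w z" for u v :: "real \<times> real"
    proof -
      obtain u1 u2 v1 v2 where "u = (u1, u2)" "v = (v1, v2)" by (metis surj_pair)
      then show ?thesis using hi[of u1 u2 v1 v2] by blast
    qed
    show "\<exists>w z. ?g ` cbox u v = cbox w z" for u v
      using gi[of u v] by blast
  qed (simp_all add: vec_eq_iff forall_2)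
  then show ?thesis by (simp add: hi)
qed

lemma polar_coordinates_inj:
  assumes "cis a * of_real s = cis b * of_real t" "0 < s" "0 < t"
    and "- pi < a" "a \<le> pi" "- pi < b" "b \<le> pi"
  shows "a = b \<and> s = t"
proof -
  have "s = t" using arg_cong[OF assms(1), of norm] assms(2,3) by (simp add: norm_mult)
  then have "cis a = cis b" using assms by simp
  then have "Arg (cis a) = Arg (cis b)" by simp
  then show ?thesis using \<open>s = t\<close> assms by (simp add: Arg_cis)
qed

text \<open>With Wirtinger derivatives \<open>a\<close> and \<open>b\<close> the Jacobian is |a|^2 -
  |b|^2, and polar coordinates contribute the factor \<rho>. Radial bounds on the density therefore
  integrate to 2 pi times a one-dimensional integral.\<close>

lemma measure_image_ball_polar:
  fixes f :: "complex \<Rightarrow> complex" and a b :: "complex \<Rightarrow> complex" and lo hi :: "real \<Rightarrow> real"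
  assumes "0 < r" and cont: "continuous_on (cball 0 r) f" and inj: "inj_on f (ball 0 r)"
    and der: "\<And>z. z \<in> ball 0 r \<Longrightarrow> (f has_derivative (\<lambda>w. a z * w + b z * cnj w)) (at z)"
    and contl: "continuous_on {0..r} lo" and conth: "continuous_on {0..r} hi"
    and lo: "\<And>z. z \<in> ball 0 r \<Longrightarrow> lo (cmod z) \<le> \<bar>(cmod (a z))\<^sup>2 - (cmod (b z))\<^sup>2\<bar>"
    and hi: "\<And>z. z \<in> ball 0 r \<Longrightarrow> \<bar>(cmod (a z))\<^sup>2 - (cmod (b z))\<^sup>2\<bar> \<le> hi (cmod z)"
  shows "2 * pi * integral {0..r} (\<lambda>\<rho>. lo \<rho> * \<rho>) \<le> measure lebesgue (f ` ball 0 r)" (is ?L)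
    and "measure lebesgue (f ` ball 0 r) \<le> 2 * pi * integral {0..r} (\<lambda>\<rho>. hi \<rho> * \<rho>)" (is ?U)
proof -
  \<comment> \<open>The centre is left out and the angle runs over the range of \<open>Arg\<close>,
    so polar coordinates are injective on \<open>S\<close>; the closed box \<open>?Q\<close> exceeds
    it only by a null set.\<close>
  define S :: "(real^2) set" where "S = {v. 0 < v $ 1 \<and> v $ 1 < r \<and> - pi < v $ 2 \<and> v $ 2 \<le> pi}"
  let ?Q = "cbox (vector [0, - pi]) (vector [r, pi]) :: (real^2) set"
  define P where "P v = cis (v $ 2) * of_real (v $ 1)" for v :: "real^2"
  define P' where "P' v w = cis (v $ 2) * (of_real (w $ 1) + \<i> * of_real (v $ 1) * of_real (w $ 2))"
    for v w :: "real^2"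
  define F where "F v = vec2_of_complex (f (P v))" for v
  define F' where "F' v w = vec2_of_complex (a (P v) * P' v w + b (P v) * cnj (P' v w))" for v w
  have PS: "P v \<in> ball 0 r - {0}" if "v \<in> S" for v
    using that by (auto simp: S_def P_def norm_mult)
  have imP: "P ` S = ball 0 r - {0}"
  proof -
    have "z \<in> P ` S" if "z \<in> ball 0 r - {0}" for z
    proof (rule image_eqI[of _ _ "vector [cmod z, Arg z]"])
      show "z = P (vector [cmod z, Arg z])"
        using that by (simp add: P_def) (metis mult.commute rcis_cmod_Arg rcis_def)
      show "vector [cmod z, Arg z] \<in> S"
        using that Arg_bounded[of z] by (simp add: S_def)
    qed
    moreover have "P ` S \<subseteq> ball 0 r - {0}" using PS by (rule image_subsetI)
    ultimately show ?thesis by (intro equalityI subsetI) (assumption | erule subsetD, assumption)+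
  qed
  have injP: "inj_on P S"
  proof (rule inj_onI)
    fix v w assume "v \<in> S" "w \<in> S" "P v = P w"
    then show "v = w"
      using polar_coordinates_inj[of "v $ 2" "v $ 1" "w $ 2" "w $ 1"]
      by (simp add: P_def S_def vec_eq_iff forall_2)
  qed
  have injF: "inj_on F S"
  proof (rule inj_onI)
    fix v w assume vw: "v \<in> S" "w \<in> S" "F v = F w"
    then have "f (P v) = f (P w)" unfolding F_def by (metis vec2_of_complex_inverse)
    then show "v = w" using vw PS inj injP by (meson DiffD1 inj_onD)
  qed
  have derP: "(P has_derivative P' v) (at v)" for v
  proof -
    have nth: "((\<lambda>v. v $ i) has_derivative (\<lambda>w. w $ i)) (at v)" for i
      by (rule bounded_linear_imp_has_derivative[OF bounded_linear_vec_nth])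
    have ofr: "((\<lambda>v. complex_of_real (v $ i)) has_derivative (\<lambda>w. of_real (w $ i))) (at v)" for i
      by (rule has_derivative_of_real[OF nth])
    have "((\<lambda>v. \<i> * complex_of_real (v $ 2)) has_derivative (\<lambda>w. \<i> * of_real (w $ 2))) (at v)"
      by (rule has_derivative_mult_right[OF ofr])
    from has_derivative_compose[OF this DERIV_exp[unfolded has_field_derivative_def]]
    have "((\<lambda>v. exp (\<i> * complex_of_real (v $ 2))) has_derivative
            (\<lambda>w. exp (\<i> * complex_of_real (v $ 2)) * (\<i> * of_real (w $ 2)))) (at v)" .
    from has_derivative_mult[OF this ofr] show ?thesis
      unfolding P_def[abs_def] P'_def[abs_def] cis_conv_exp by (simp add: algebra_simps)
  qed
  have derF: "(F has_derivative F' v) (at v within S)" if "v \<in> S" for v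
  proof -
    have "(f has_derivative (\<lambda>w. a (P v) * w + b (P v) * cnj w)) (at (P v))"
      using der PS[OF that] by blast
    from diff_chain_at[OF derP this]
    have "((\<lambda>v. f (P v)) has_derivative (\<lambda>w. a (P v) * P' v w + b (P v) * cnj (P' v w))) (at v)"
      by (simp add: o_def)
    from bounded_linear.has_derivative[OF bounded_linear_vec2_of_complex this]
    show ?thesis unfolding F_def F'_def by (rule has_derivative_at_withinI)
  qed
  have detF: "\<bar>det (matrix (F' v))\<bar> = \<bar>(cmod (a (P v)))\<^sup>2 - (cmod (b (P v)))\<^sup>2\<bar> * v $ 1"
    if "v \<in> S" for v
  proof -
    \<comment> \<open>Abstracting the angle to a number \<open>c\<close> of modulus 1 turns the
      determinant formula into a polynomial identity.\<close>
    define c where "c = cis (v $ 2)"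
    have c: "(Re c)\<^sup>2 + (Im c)\<^sup>2 = 1" by (simp add: c_def)
    obtain a1 a2 b1 b2 where ab: "a (P v) = Complex a1 a2" "b (P v) = Complex b1 b2"
      by (metis complex.exhaust)
    have "det (matrix (F' v)) = ((a1\<^sup>2 + a2\<^sup>2) - (b1\<^sup>2 + b2\<^sup>2)) * ((Re c)\<^sup>2 + (Im c)\<^sup>2) * v $ 1"
      unfolding det_2 matrix_def F'_def P'_def c_def[symmetric] ab
      by (simp add: axis_def) algebra
    then show ?thesis
      using that unfolding c by (simp add: ab cmod_power2 abs_mult S_def)
  qed
  \<comment> \<open>Openness by invariance of domain and boundedness by compactness make the image
    measurable with finite area.\<close>
  have fop: "open (f ` ball 0 r)"
    using cont inj by (intro invariance_of_domain) (auto intro: continuous_on_subset)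
  have "compact (f ` cball 0 r)" by (intro compact_continuous_image cont) auto
  then have "bounded (f ` ball 0 r)"
    by (meson ball_subset_cball bounded_subset compact_imp_bounded image_mono)
  then have flm: "f ` ball 0 r \<in> lmeasurable"
    using fop by (simp add: lmeasurable_open)
  have imF: "F ` S = vec2_of_complex ` (f ` (ball 0 r - {0}))"
    unfolding F_def imP[symmetric] by (simp add: image_image)
  \<comment> \<open>Omitting the centre removes a single point from the image, hence no
    area.\<close>
  have feq: "f ` (ball 0 r - {0}) = f ` ball 0 r - {f 0}"
    using inj \<open>0 < r\<close> by (auto simp: inj_on_def)
  have meq: "measure lebesgue (F ` S) = measure lebesgue (f ` ball 0 r)"
    unfolding imF feq using fop
    by (subst measure_vec2_of_complex_image) (auto simp: measure_Diff_null_set)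
  have "F ` S \<in> lmeasurable"
  proof -
    have "open (vec2_of_complex ` (f ` ball 0 r - {f 0}))"
    proof -
      have "vec2_of_complex ` (f ` ball 0 r - {f 0}) = complex_of_vec2 -` (f ` ball 0 r - {f 0})"
        by (rule vec2_of_complex_image)
      then show ?thesis
        using fop bounded_linear.continuous_on[OF bounded_linear_complex_of_vec2 continuous_on_id]
        by (simp add: open_vimage open_delete)
    qed
    moreover have "bounded (vec2_of_complex ` (f ` ball 0 r - {f 0}))"
      using \<open>bounded (f ` ball 0 r)\<close> bounded_linear_vec2_of_complex
      by (meson bounded_diff bounded_linear_image bounded_subset Diff_subset)
    ultimately show ?thesis unfolding imF feq by (simp add: lmeasurable_open)
  qed
  moreover have Sm: "S \<in> sets lebesgue"
  proof -
    have "S \<in> sets borel" unfolding S_def by measurable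
    then show ?thesis by simp
  qed
  ultimately have hi_S: "((\<lambda>v. \<bar>det (matrix (F' v))\<bar>) has_integral measure lebesgue (f ` ball 0 r)) S"
    using has_measure_differentiable_image[OF Sm derF injF] meq by blast
  have SQ: "S \<subseteq> ?Q" by (auto simp: S_def mem_box_cart forall_2)
  have neg: "negligible (?Q - S)"
  proof (rule negligible_subset)
    show "negligible ({v::real^2. v $ 1 = 0} \<union> {v. v $ 1 = r} \<union> {v. v $ 2 = - pi})"
      using negligible_standard_hyperplane[of "axis _ 1 :: real^2"]
      by (intro negligible_Un) (simp_all add: inner_axis axis_in_Basis_iff)
    show "?Q - S \<subseteq> {v. v $ 1 = 0} \<union> {v. v $ 1 = r} \<union> {v. v $ 2 = - pi}"
      by (auto simp: S_def mem_box_cart forall_2)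
  qed
  have int: "((\<lambda>v. \<psi> (v $ 1)) has_integral (2 * pi * integral {0..r} \<psi>)) S"
    if "continuous_on {0..r} \<psi>" for \<psi> :: "real \<Rightarrow> real"
  proof -
    have "((\<lambda>v. \<psi> (v $ 1)) has_integral (2 * pi * integral {0..r} \<psi>)) ?Q"
      using has_integral_cbox_vec2_fst[OF that, of "- pi" pi] by simp
    moreover have "negligible {v \<in> S - ?Q. \<psi> (v $ 1) \<noteq> 0}" "negligible {v \<in> ?Q - S. \<psi> (v $ 1) \<noteq> 0}"
      using SQ by (auto intro: negligible_subset[OF neg] negligible_subset[OF negligible_empty])
    ultimately show ?thesis
      by (subst has_integral_spike_set_eq)
  qed
  have n: "cmod (P v) = v $ 1" if "v \<in> S" for v
    using that by (simp add: P_def S_def norm_mult)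
  show ?L
  proof (rule has_integral_le[OF int hi_S])
    show "continuous_on {0..r} (\<lambda>\<rho>. lo \<rho> * \<rho>)" by (intro continuous_intros contl)
    show "lo (v $ 1) * v $ 1 \<le> \<bar>det (matrix (F' v))\<bar>" if "v \<in> S" for v
      unfolding detF[OF that] using lo[of "P v"] PS[OF that] n[OF that] that
      by (intro mult_right_mono) (auto simp: S_def)
  qed
  show ?U
  proof (rule has_integral_le[OF hi_S int])
    show "continuous_on {0..r} (\<lambda>\<rho>. hi \<rho> * \<rho>)" by (intro continuous_intros conth)
    show "\<bar>det (matrix (F' v))\<bar> \<le> hi (v $ 1) * v $ 1" if "v \<in> S" for v
      unfolding detF[OF that] using hi[of "P v"] PS[OF that] n[OF that] that
      by (intro mult_right_mono) (auto simp: S_def)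
  qed
qed

subsection \<open>Caratheodory functions\<close>

text \<open>For 0 \<le> t < 1 this is the closed disc of centre (1 + t^2) / (1 - t^2) and radius
  2 t / (1 - t^2), i.e. the image of the disc of radius t under u \<mapsto> (1 + u) / (1 - u).\<close>

definition in_hyp_disc :: "real \<Rightarrow> complex \<Rightarrow> bool" where
  "in_hyp_disc t p \<longleftrightarrow> (cmod p)\<^sup>2 + 1 \<le> 2 * ((1 + t\<^sup>2) / (1 - t\<^sup>2)) * Re p"

text \<open>The Cayley transform (p - 1) / (p + 1) maps the disc into itself and fixes 0, so
  Schwarz's lemma bounds it by |w|. Squaring and expanding that bound gives the disc
  inequality.\<close>

lemma caratheodory_disc:
  assumes hol: "p holomorphic_on ball 0 1" and p0: "p 0 = 1"
    and pos: "\<And>w. w \<in> ball 0 1 \<Longrightarrow> Re (p w) > 0" and w: "w \<in> ball 0 1"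
  shows "in_hyp_disc (cmod w) (p w)"
proof -
  have nz: "p v + 1 \<noteq> 0" if "v \<in> ball 0 1" for v
    using pos[OF that] by (auto simp: complex_eq_iff)
  define u where "u v = (p v - 1) / (p v + 1)" for v
  have uh: "u holomorphic_on ball 0 1"
    unfolding u_def[abs_def] using nz by (intro holomorphic_intros hol) auto
  have sq: "(cmod (p v + 1))\<^sup>2 = (cmod (p v))\<^sup>2 + 2 * Re (p v) + 1"
    "(cmod (p v - 1))\<^sup>2 = (cmod (p v))\<^sup>2 - 2 * Re (p v) + 1" for v
    by (simp_all add: cmod_power2) (simp_all add: power2_eq_square algebra_simps)
  have lt: "cmod (u v) < 1" if "cmod v < 1" for v
  proof -
    have "(cmod (p v - 1))\<^sup>2 < (cmod (p v + 1))\<^sup>2"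
      using pos[of v] that by (simp add: sq)
    then have "cmod (p v - 1) < cmod (p v + 1)" by (rule power2_less_imp_less) simp
    then show ?thesis using nz[of v] that by (simp add: u_def norm_divide)
  qed
  have "cmod (u w) \<le> cmod w"
    by (rule Schwarz_Lemma(1)[OF uh _ lt]) (use w in \<open>simp_all add: u_def p0\<close>)
  then have "cmod (p w - 1) \<le> cmod w * cmod (p w + 1)"
    using nz[OF w] by (simp add: u_def norm_divide divide_le_eq)
  then have "(cmod (p w - 1))\<^sup>2 \<le> (cmod w)\<^sup>2 * (cmod (p w + 1))\<^sup>2"
    by (metis norm_ge_zero power_mono power_mult_distrib)
  then have "((cmod (p w))\<^sup>2 + 1) * (1 - (cmod w)\<^sup>2) \<le> 2 * (1 + (cmod w)\<^sup>2) * Re (p w)"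
    unfolding sq by (simp add: algebra_simps)
  moreover have "(cmod w)\<^sup>2 < 1" using w by (simp add: power_less_one_iff abs_square_less_1)
  ultimately show ?thesis by (simp add: in_hyp_disc_def field_simps)
qed

text \<open>The two bounds are the roots of the quadratic, which splits into linear factors once
  denominators are cleared.\<close>

lemma quadratic_bounds:
  fixes t x :: real
  assumes t: "0 \<le> t" "t < 1" and x: "x\<^sup>2 + 1 \<le> 2 * ((1 + t\<^sup>2) / (1 - t\<^sup>2)) * x"
  shows "(1 - t) / (1 + t) \<le> x" "x \<le> (1 + t) / (1 - t)"
proof -
  have t2: "1 - t\<^sup>2 > 0" using t by (simp add: abs_square_less_1)
  \<comment> \<open>Positivity of \<open>x\<close> orders the two linear factors, so the nonpositive
    product determines the sign of each.\<close>
  have "x > 0"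
  proof (rule ccontr)
    assume "\<not> x > 0"
    then have "2 * ((1 + t\<^sup>2) / (1 - t\<^sup>2)) * x \<le> 0"
      using t2 by (intro mult_nonneg_nonpos) auto
    then show False using x by (smt (verit) zero_le_power2)
  qed
  have "(x * (1 + t) - (1 - t)) * (x * (1 - t) - (1 + t)) \<le> 0"
  proof -
    have "(x\<^sup>2 + 1) * (1 - t\<^sup>2) \<le> 2 * (1 + t\<^sup>2) * x"
      using x t2 by (simp add: field_simps)
    then show ?thesis by (simp add: algebra_simps power2_eq_square)
  qed
  moreover have "(x * (1 + t) - (1 - t)) - (x * (1 - t) - (1 + t)) = 2 * t * (x + 1)"
    by (simp add: algebra_simps)
  moreover have "2 * t * (x + 1) \<ge> 0" using t \<open>x > 0\<close> by simp
  moreover have "a \<ge> 0 \<and> b \<le> 0" if "a * b \<le> 0" "a - b \<ge> 0" for a b :: real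
    using that mult_neg_neg[of a b] mult_pos_pos[of a b] by linarith
  ultimately have "x * (1 + t) - (1 - t) \<ge> 0" "x * (1 - t) - (1 + t) \<le> 0"
    by metis+
  then show "(1 - t) / (1 + t) \<le> x" "x \<le> (1 + t) / (1 - t)"
    using t by (simp_all add: field_simps)
qed

text \<open>The defining inequality survives lowering |p|^2 to (Re p)^2 and also raising Re p to
  |p|, so \<open>Re p\<close> and \<open>cmod p\<close> both satisfy the same quadratic
  inequality.\<close>

lemma in_hyp_disc_bounds:
  assumes t: "0 \<le> t" "t < 1" and p: "in_hyp_disc t p"
  shows "(1 - t) / (1 + t) \<le> Re p" "cmod p \<le> (1 + t) / (1 - t)"
proof -
  have t2: "1 - t\<^sup>2 > 0" using t by (simp add: abs_square_less_1)
  have "(Re p)\<^sup>2 \<le> (cmod p)\<^sup>2" by (simp add: cmod_power2)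
  then have "(Re p)\<^sup>2 + 1 \<le> 2 * ((1 + t\<^sup>2) / (1 - t\<^sup>2)) * Re p"
    using p by (simp add: in_hyp_disc_def)
  then show "(1 - t) / (1 + t) \<le> Re p" using quadratic_bounds t by blast
  have "2 * ((1 + t\<^sup>2) / (1 - t\<^sup>2)) * Re p \<le> 2 * ((1 + t\<^sup>2) / (1 - t\<^sup>2)) * cmod p"
    using t2 by (intro mult_left_mono complex_Re_le_cmod) auto
  then have "(cmod p)\<^sup>2 + 1 \<le> 2 * ((1 + t\<^sup>2) / (1 - t\<^sup>2)) * cmod p"
    using p by (simp add: in_hyp_disc_def)
  then show "cmod p \<le> (1 + t) / (1 - t)" using quadratic_bounds t by blast
qed

text \<open>The value ((1 - t) / (1 + t))^2 is the true minimum as long as t \<le> 2 - sqrt 3; beyond that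
  the product can wind past it.  The error term is chosen as t D'(t) for D(t) = 8 t^3 / (1 - t^2),
  which is what the slack in the final area estimate can absorb.\<close>

lemma Re_mult_in_hyp_disc_ge:
  assumes t: "0 \<le> t" "t < 1" and p: "in_hyp_disc t p" and q: "in_hyp_disc t q"
  shows "Re (p * q) \<ge> ((1 - t) / (1 + t))\<^sup>2 - (24 * t ^ 3 - 8 * t ^ 5) / (1 - t\<^sup>2)\<^sup>2"
proof -
  have t2: "1 - t\<^sup>2 > 0" using t by (simp add: abs_square_less_1)
  \<comment> \<open>Centre and radius of the disc. Since C^2 - R^2 = 1, membership means |p - C|
    \<le> R.\<close>
  define C where "C = (1 + t\<^sup>2) / (1 - t\<^sup>2)"
  define R where "R = 2 * t / (1 - t\<^sup>2)"
  have CR: "C\<^sup>2 - R\<^sup>2 = 1"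
    using t2 by (simp add: C_def R_def power_divide diff_divide_distrib[symmetric])
       (simp add: power2_eq_square algebra_simps)
  have f: "1 - t\<^sup>2 = (1 - t) * (1 + t)" by (simp add: power2_eq_square algebra_simps)
  have CmR: "C - R = (1 - t) / (1 + t)"
    using t unfolding C_def R_def f diff_divide_distrib[symmetric]
    by (simp add: divide_simps) (simp add: power2_eq_square algebra_simps)
  have R0: "R \<ge> 0" using t t2 by (simp add: R_def)
  have m0: "C - R > 0" unfolding CmR using t by simp
  have "(cmod (p - C))\<^sup>2 \<le> R\<^sup>2"
  proof -
    have "(cmod (p - C))\<^sup>2 = (cmod p)\<^sup>2 - 2 * C * Re p + C\<^sup>2"
      by (simp add: cmod_power2) (simp add: power2_eq_square algebra_simps)
    then show ?thesis using p CR by (simp add: in_hyp_disc_def C_def)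
  qed
  then have pC: "cmod (p - C) \<le> R" using R0 by (rule power2_le_imp_le)
  have "Re (p * q) = C * Re q + Re ((p - C) * q)" by (simp add: algebra_simps)
  moreover have "\<bar>Re ((p - C) * q)\<bar> \<le> R * cmod q"
    by (rule order_trans[OF abs_Re_le_cmod]) (simp add: norm_mult mult_right_mono pC)
  \<comment> \<open>Writing p = C + (p - C) eliminates \<open>p\<close>; what remains is to minimise
    the right-hand side over \<open>q\<close>.\<close>
  ultimately have 1: "Re (p * q) \<ge> C * Re q - R * cmod q" by linarith
  have q2: "(cmod q)\<^sup>2 + 1 \<le> 2 * C * Re q" using q by (simp add: in_hyp_disc_def C_def)
  have Rq: "C - R \<le> Re q" unfolding CmR using in_hyp_disc_bounds(1)[OF t q] .
  have d: "(24 * t ^ 3 - 8 * t ^ 5) / (1 - t\<^sup>2)\<^sup>2 \<ge> 0"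
  proof -
    have "t ^ 5 \<le> t ^ 3" using t by (intro power_decreasing) auto
    moreover have "0 \<le> t ^ 3" using t by simp
    ultimately have "0 \<le> 24 * t ^ 3 - 8 * t ^ 5" by linarith
    then show ?thesis by simp
  qed
  \<comment> \<open>The threshold is t = 2 - sqrt 3. Up to it, AM-GM against \<open>C - R\<close>
    leaves the nonnegative weight \<open>C * (C - 2 * R)\<close> on \<open>Re q\<close>, and
    \<open>Re q \<ge> C - R\<close> gives the bound without any error term.\<close>
  show ?thesis
  proof (cases "C \<ge> 2 * R")
    case True
    have "2 * ((C - R) * cmod q) \<le> (cmod q)\<^sup>2 + (C - R)\<^sup>2"
      using zero_le_power2[of "cmod q - (C - R)"]
      by (simp add: power2_diff[of "cmod q"] mult.assoc mult.left_commute mult.commute)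
    also have "\<dots> \<le> 2 * C * Re q - 1 + (C - R)\<^sup>2" using q2 by simp
    also have "\<dots> = 2 * (C * Re q - R * (C - R))"
      using CR by (simp add: power2_eq_square algebra_simps)
    finally have "(C - R) * cmod q \<le> C * Re q - R * (C - R)"
      by simp
    then have "R * ((C - R) * cmod q) \<le> R * (C * Re q - R * (C - R))"
      using R0 by (rule mult_left_mono)
    moreover have "(C * (C - 2 * R)) * (C - R) \<le> (C * (C - 2 * R)) * Re q"
      using True R0 Rq by (intro mult_left_mono) auto
    ultimately have "(C - R) * (C - R)\<^sup>2 \<le> (C - R) * (C * Re q - R * cmod q)"
      by (simp add: power2_eq_square algebra_simps)
    then have "(C - R)\<^sup>2 \<le> C * Re q - R * cmod q" using m0 by simp
    then show ?thesis using 1 d unfolding CmR by linarith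
  next
    case False
    have C2R: "C - 2 * R = (1 + t\<^sup>2 - 4 * t) / (1 - t\<^sup>2)"
      by (simp add: C_def R_def diff_divide_distrib)
    have "C - 2 * R < 0" using False by simp
    then have "1 + t\<^sup>2 < 4 * t" using t2 unfolding C2R by (simp add: divide_less_0_iff)
    \<comment> \<open>Beyond the threshold AM-GM is taken against \<open>R\<close> instead. It loses
      (C - 2 R)^2 / 2, which the cubic error absorbs because t > 1/4 here.\<close>
    have "2 * R * cmod q \<le> (cmod q)\<^sup>2 + R\<^sup>2"
      using zero_le_power2[of "cmod q - R"] by (simp add: power2_diff mult_ac)
    then have "C * Re q - R * cmod q \<ge> (C\<^sup>2 - 2 * R\<^sup>2) / 2"
      using q2 CR by simp
    moreover have "(C\<^sup>2 - 2 * R\<^sup>2) / 2 = (C - R)\<^sup>2 - (C - 2 * R)\<^sup>2 / 2"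
      by (simp add: power2_eq_square field_simps)
    moreover have "(C - 2 * R)\<^sup>2 / 2 \<le> (24 * t ^ 3 - 8 * t ^ 5) / (1 - t\<^sup>2)\<^sup>2"
    proof -
      have "(1 + t\<^sup>2 - 4 * t)\<^sup>2 / 2 \<le> 24 * t ^ 3 - 8 * t ^ 5"
      proof -
        have "4 * t - (1 + t\<^sup>2) \<le> 2 * t" using zero_le_power2[of "1 - t"] by (simp add: power2_diff)
        then have "(4 * t - (1 + t\<^sup>2))\<^sup>2 \<le> (2 * t)\<^sup>2"
          using \<open>1 + t\<^sup>2 < 4 * t\<close> by (intro power_mono) auto
        then have "(1 + t\<^sup>2 - 4 * t)\<^sup>2 \<le> 4 * t\<^sup>2" by (simp add: power2_commute power_mult_distrib)
        also have "\<dots> \<le> 4 * t\<^sup>2 * (4 * t)"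
        proof -
          have "1 \<le> 4 * t" using \<open>1 + t\<^sup>2 < 4 * t\<close> by (smt (verit) zero_le_power2)
          then have "4 * t\<^sup>2 * 1 \<le> 4 * t\<^sup>2 * (4 * t)" by (intro mult_left_mono) auto
          then show ?thesis by simp
        qed
        also have "\<dots> = 16 * t ^ 3" by (simp add: power2_eq_square power3_eq_cube)
        finally have "(1 + t\<^sup>2 - 4 * t)\<^sup>2 \<le> 16 * t ^ 3" .
        moreover have "t ^ 5 \<le> t ^ 3" using t by (intro power_decreasing) auto
        moreover have "0 \<le> t ^ 3" using t by simp
        ultimately show ?thesis by linarith
      qed
      then show ?thesis
        using divide_right_mono[of "(1 + t\<^sup>2 - 4 * t)\<^sup>2 / 2" "24 * t ^ 3 - 8 * t ^ 5" "(1 - t\<^sup>2)\<^sup>2"]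
        unfolding C2R by (simp add: power_divide)
    qed
    ultimately show ?thesis using 1 unfolding CmR by linarith
  qed
qed

subsection \<open>Growth of starlike pairs\<close>

text \<open>At v = s c on the ray through \<open>w\<close>, \<open>Re (v * deriv W v)\<close> is s
  times the derivative of \<open>Re W\<close> in s. The hypothesis thus compares radial derivatives,
  and \<open>Re W - E\<close> increases along the ray.\<close>

lemma Re_radial_growth:
  assumes hol: "W holomorphic_on ball 0 1" and w: "w \<in> ball 0 1"
    and E: "\<And>t. 0 \<le> t \<Longrightarrow> t < 1 \<Longrightarrow> (E has_real_derivative E' t) (at t)"
    and le: "\<And>v. v \<in> ball 0 1 \<Longrightarrow> cmod v * E' (cmod v) \<le> Re (v * deriv W v)"
  shows "E (cmod w) - E 0 \<le> Re (W w - W 0)"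
proof (cases "w = 0")
  case False
  define c where "c = w / of_real (cmod w)"
  have c: "cmod c = 1" "of_real (cmod w) * c = w" using False by (simp_all add: c_def norm_divide)
  define g where "g s = Re (W (of_real s * c)) - E s" for s
  have der: "(g has_real_derivative Re (c * deriv W (of_real s * c)) - E' s) (at s)"
    if s: "0 \<le> s" "s \<le> cmod w" for s
  proof -
    have sb: "of_real s * c \<in> ball 0 1" using s w c by (simp add: norm_mult)
    then have "(W has_field_derivative deriv W (of_real s * c)) (at (of_real s * c))"
      using hol holomorphic_derivI open_ball by blast
    moreover have "((\<lambda>s. of_real s * c) has_vector_derivative c) (at s)"
      by (auto intro!: derivative_eq_intros)
    ultimately have "((\<lambda>s. W (of_real s * c)) has_vector_derivative c * deriv W (of_real s * c)) (at s)"
      by (auto dest: field_vector_diff_chain_at simp: o_def)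
    then have "((\<lambda>s. Re (W (of_real s * c))) has_real_derivative Re (c * deriv W (of_real s * c))) (at s)"
      by (rule has_field_derivative_Re)
    then show ?thesis
      unfolding g_def[abs_def] using s w by (intro DERIV_diff E) auto
  qed
  \<comment> \<open>The factor \<open>s\<close> can be cancelled only for s > 0; at the end points
    continuity suffices.\<close>
  have "g 0 \<le> g (cmod w)"
  proof (rule DERIV_nonneg_imp_increasing_open[where f = g])
    fix s assume s: "0 < s" "s < cmod w"
    have "of_real s * c \<in> ball 0 1" "cmod (of_real s * c) = s"
      using s w c by (simp_all add: norm_mult)
    then have "s * E' s \<le> s * Re (c * deriv W (of_real s * c))"
      using le[of "of_real s * c"] by (simp add: mult.assoc)
    then have "0 \<le> Re (c * deriv W (of_real s * c)) - E' s" using s by simp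
    then show "\<exists>y. DERIV g s :> y \<and> y \<ge> 0" using der[of s] s by auto
  next
    show "continuous_on {0..cmod w} g"
      by (rule continuous_at_imp_continuous_on) (use der DERIV_isCont in fastforce)
  qed simp
  then show ?thesis using c by (simp add: g_def)
qed simp

text \<open>Everything is a function of w = z^k, so the order of symmetry is absent here and enters
  only as the constant \<kappa> of \<open>Re_log_bounds\<close>.\<close>

locale starlike_pair =
  fixes \<alpha> :: real and A B :: "complex \<Rightarrow> complex"
  assumes \<alpha>: "0 \<le> \<alpha>" "\<alpha> < 1"
    and holA: "A holomorphic_on ball 0 1" and holB: "B holomorphic_on ball 0 1"
    and A0: "A 0 = 1" and B0: "B 0 = 0"
    and Re_diff: "\<And>w. w \<in> ball 0 1 \<Longrightarrow> \<alpha> < Re (A w - B w)"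
    and less: "\<And>w. w \<in> ball 0 1 \<Longrightarrow> cmod (B w) < cmod (A w)"
begin

text \<open>\<open>p0\<close> is A - B, rescaled to have value 1 at 0 and positive real part.
  \<open>q\<close> is the Cayley transform of B / A, which turns |B| < |A| into positivity of its
  real part.\<close>

definition "p0 w = (A w - B w - of_real \<alpha>) / of_real (1 - \<alpha>)"
definition "q w = (A w + B w) / (A w - B w)"

lemma diff_nonzero: "w \<in> ball 0 1 \<Longrightarrow> A w - B w \<noteq> 0"
  using Re_diff \<alpha> by fastforce

lemma diff_eq: "A w - B w = of_real \<alpha> + of_real (1 - \<alpha>) * p0 w"
  using \<alpha> by (simp add: p0_def flip: of_real_diff)

lemma add_eq: "w \<in> ball 0 1 \<Longrightarrow> A w + B w = (of_real \<alpha> + of_real (1 - \<alpha>) * p0 w) * q w"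
  unfolding diff_eq[symmetric] using diff_nonzero by (simp add: q_def)

text \<open>The left-hand side is the real part of (A + B) times the conjugate of A - B, and A + B =
  q (A - B).\<close>

lemma norm_diff_squares:
  assumes "w \<in> ball 0 1"
  shows "(cmod (A w))\<^sup>2 - (cmod (B w))\<^sup>2 = (cmod (A w - B w))\<^sup>2 * Re (q w)"
proof -
  have "A w + B w = q w * (A w - B w)" using diff_nonzero[OF assms] by (simp add: q_def)
  then have "(A w + B w) * cnj (A w - B w) = of_real ((cmod (A w - B w))\<^sup>2) * q w"
    by (simp only: mult.assoc complex_norm_square[symmetric]) (simp add: mult.commute)
  then have "Re ((A w + B w) * cnj (A w - B w)) = Re (of_real ((cmod (A w - B w))\<^sup>2) * q w)"
    by (rule arg_cong)
  also have "\<dots> = (cmod (A w - B w))\<^sup>2 * Re (q w)"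
    by (simp del: of_real_power)
  finally show ?thesis by (simp add: cmod_power2) (simp add: power2_eq_square algebra_simps)
qed

lemma in_hyp_disc_p0: "w \<in> ball 0 1 \<Longrightarrow> in_hyp_disc (cmod w) (p0 w)"
proof (rule caratheodory_disc)
  show "p0 holomorphic_on ball 0 1"
    unfolding p0_def[abs_def] using \<alpha> by (intro holomorphic_intros holA holB) auto
  show "p0 0 = 1" using \<alpha> by (simp add: p0_def A0 B0)
  show "0 < Re (p0 w)" if "w \<in> ball 0 1" for w
    using Re_diff[OF that] \<alpha> by (simp add: p0_def Re_divide_of_real)
qed

lemma in_hyp_disc_q: "w \<in> ball 0 1 \<Longrightarrow> in_hyp_disc (cmod w) (q w)"
proof (rule caratheodory_disc)
  show "q holomorphic_on ball 0 1"
    unfolding q_def[abs_def] using diff_nonzero by (intro holomorphic_intros holA holB) auto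
  show "q 0 = 1" by (simp add: q_def A0 B0)
  show "0 < Re (q w)" if "w \<in> ball 0 1" for w
  proof -
    have "(cmod (A w))\<^sup>2 - (cmod (B w))\<^sup>2 > 0"
      using less[OF that] by (simp add: power_strict_mono)
    then show ?thesis
      unfolding norm_diff_squares[OF that] using diff_nonzero[OF that] by (simp add: zero_less_mult_iff)
  qed
qed

text \<open>A + B is the convex combination of \<open>q\<close> and \<open>p0 * q\<close> with
  weights \<alpha> and 1 - \<alpha>, and each of the two is bounded separately.\<close>

lemma Re_add_ge:
  assumes w: "w \<in> ball 0 1" and t: "t = cmod w"
  shows "\<alpha> * ((1 - t) / (1 + t)) +
           (1 - \<alpha>) * (((1 - t) / (1 + t))\<^sup>2 - (24 * t ^ 3 - 8 * t ^ 5) / (1 - t\<^sup>2)\<^sup>2)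
         \<le> Re (A w + B w)"
proof -
  have t01: "0 \<le> t" "t < 1" using w t by auto
  have eq: "Re (A w + B w) = \<alpha> * Re (q w) + (1 - \<alpha>) * Re (p0 w * q w)"
    unfolding add_eq[OF w] by (simp add: algebra_simps)
  have "(1 - t) / (1 + t) \<le> Re (q w)"
    using in_hyp_disc_bounds(1)[OF t01] in_hyp_disc_q[OF w] t by blast
  moreover have "((1 - t) / (1 + t))\<^sup>2 - (24 * t ^ 3 - 8 * t ^ 5) / (1 - t\<^sup>2)\<^sup>2 \<le> Re (p0 w * q w)"
    using Re_mult_in_hyp_disc_ge[OF t01] in_hyp_disc_q[OF w] in_hyp_disc_p0[OF w] t by blast
  ultimately show ?thesis unfolding eq using \<alpha> by (intro add_mono mult_left_mono) auto
qed

lemma Re_add_le: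
  assumes w: "w \<in> ball 0 1" and t: "t = cmod w"
  shows "Re (A w + B w) \<le> \<alpha> * ((1 + t) / (1 - t)) + (1 - \<alpha>) * ((1 + t) / (1 - t))\<^sup>2"
proof -
  have t01: "0 \<le> t" "t < 1" using w t by auto
  have q: "cmod (q w) \<le> (1 + t) / (1 - t)" and p: "cmod (p0 w) \<le> (1 + t) / (1 - t)"
    using in_hyp_disc_bounds(2)[OF t01] in_hyp_disc_q[OF w] in_hyp_disc_p0[OF w] t by blast+
  have eq: "Re (A w + B w) = \<alpha> * Re (q w) + (1 - \<alpha>) * Re (p0 w * q w)"
    unfolding add_eq[OF w] by (simp add: algebra_simps)
  have "Re (q w) \<le> (1 + t) / (1 - t)"
    using q complex_Re_le_cmod order_trans by blast
  moreover have "Re (p0 w * q w) \<le> ((1 + t) / (1 - t))\<^sup>2"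
  proof -
    have "Re (p0 w * q w) \<le> cmod (p0 w) * cmod (q w)"
      by (metis complex_Re_le_cmod norm_mult)
    also have "\<dots> \<le> ((1 + t) / (1 - t)) * ((1 + t) / (1 - t))"
      using p q t01 by (intro mult_mono) auto
    finally show ?thesis by (simp add: power2_eq_square)
  qed
  ultimately show ?thesis unfolding eq using \<alpha> by (intro add_mono mult_left_mono) auto
qed

text \<open>In the factorisation |A - B|^2 Re q, the first factor is controlled by the disc of
  \<open>p0\<close> and the second by that of \<open>q\<close>.\<close>

lemma norm_diff_squares_bounds:
  assumes w: "w \<in> ball 0 1" and t: "t = cmod w"
  shows "((1 - (1 - 2 * \<alpha>) * t) / (1 + t))\<^sup>2 * ((1 - t) / (1 + t))
           \<le> (cmod (A w))\<^sup>2 - (cmod (B w))\<^sup>2" (is "?l \<le> _")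
    and "(cmod (A w))\<^sup>2 - (cmod (B w))\<^sup>2
           \<le> ((1 + (1 - 2 * \<alpha>) * t) / (1 - t))\<^sup>2 * ((1 + t) / (1 - t))" (is "_ \<le> ?u")
proof -
  have t01: "0 \<le> t" "t < 1" using w t by auto
  have q: "cmod (q w) \<le> (1 + t) / (1 - t)" and p: "cmod (p0 w) \<le> (1 + t) / (1 - t)"
    and q': "(1 - t) / (1 + t) \<le> Re (q w)" and p': "(1 - t) / (1 + t) \<le> Re (p0 w)"
    using in_hyp_disc_bounds[OF t01] in_hyp_disc_q[OF w] in_hyp_disc_p0[OF w] t by blast+
  have q'': "Re (q w) \<le> (1 + t) / (1 - t)" using q complex_Re_le_cmod order_trans by blast
  have Q: "\<alpha> + (1 - \<alpha>) * ((1 - t) / (1 + t)) = (1 - (1 - 2 * \<alpha>) * t) / (1 + t)"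
    and P: "\<alpha> + (1 - \<alpha>) * ((1 + t) / (1 - t)) = (1 + (1 - 2 * \<alpha>) * t) / (1 - t)"
    using t01 by (simp_all add: field_simps)
  have Q0: "0 \<le> \<alpha> + (1 - \<alpha>) * ((1 - t) / (1 + t))" using \<alpha> t01 by simp
  have "\<alpha> + (1 - \<alpha>) * ((1 - t) / (1 + t)) \<le> Re (A w - B w)"
    unfolding diff_eq using mult_left_mono[OF p', of "1 - \<alpha>"] \<alpha> by simp
  also have "\<dots> \<le> cmod (A w - B w)" by (rule complex_Re_le_cmod)
  finally have l: "\<alpha> + (1 - \<alpha>) * ((1 - t) / (1 + t)) \<le> cmod (A w - B w)" .
  have "cmod (A w - B w) \<le> cmod (of_real \<alpha>) + cmod (of_real (1 - \<alpha>) * p0 w)"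
    unfolding diff_eq by (rule norm_triangle_ineq)
  also have "\<dots> = \<alpha> + (1 - \<alpha>) * cmod (p0 w)" using \<alpha> by (simp add: norm_mult del: of_real_diff)
  also have "\<dots> \<le> \<alpha> + (1 - \<alpha>) * ((1 + t) / (1 - t))"
    using mult_left_mono[OF p, of "1 - \<alpha>"] \<alpha> by simp
  finally have u: "cmod (A w - B w) \<le> \<alpha> + (1 - \<alpha>) * ((1 + t) / (1 - t))" .
  show "?l \<le> (cmod (A w))\<^sup>2 - (cmod (B w))\<^sup>2"
    unfolding norm_diff_squares[OF w] Q[symmetric] using l q' t01 Q0
    by (intro mult_mono power_mono) auto
  have "0 \<le> (1 - t) / (1 + t)" using t01 by simp
  then have "0 \<le> Re (q w)" using q' by linarith
  then show "(cmod (A w))\<^sup>2 - (cmod (B w))\<^sup>2 \<le> ?u"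
    unfolding norm_diff_squares[OF w] P[symmetric] using u q'' 
    by (intro mult_mono power_mono) auto
qed

text \<open>\<open>W\<close> stands for the logarithm of h g as a function of w. The bounds on Re (A
  + B) bound its radial derivative, and the right-hand functions are the integrals of these
  bounds.\<close>

lemma Re_log_bounds:
  fixes W :: "complex \<Rightarrow> complex" and \<kappa> :: real
  assumes hol: "W holomorphic_on ball 0 1" and W0: "W 0 = 0" and "\<kappa> > 0"
    and W: "\<And>v. v \<in> ball 0 1 \<Longrightarrow> of_real \<kappa> * v * deriv W v = A v + B v - 1"
    and w: "w \<in> ball 0 1" and t: "t = cmod w"
  shows "- 2 * \<alpha> * ln (1 + t) - 4 * (1 - \<alpha>) * t / (1 + t) - 8 * (1 - \<alpha>) * t ^ 3 / (1 - t\<^sup>2)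
           \<le> \<kappa> * Re (W w)" (is ?L)
    and "\<kappa> * Re (W w) \<le> - 2 * \<alpha> * ln (1 - t) + 4 * (1 - \<alpha>) * t / (1 - t)" (is ?U)
proof -
  let ?V = "\<lambda>v. of_real \<kappa> * W v"
  have holV: "?V holomorphic_on ball 0 1" by (intro holomorphic_intros hol)
  have dV: "deriv ?V v = of_real \<kappa> * deriv W v" if "v \<in> ball 0 1" for v
    using holomorphic_on_imp_differentiable_at[OF hol open_ball that] by simp
  have vV: "Re (v * deriv ?V v) = Re (A v + B v) - 1" if "v \<in> ball 0 1" for v
    using arg_cong[OF W[OF that], of Re] by (simp add: dV[OF that] mult.assoc mult.left_commute)
  \<comment> \<open>\<open>t * E' t\<close> is the bound of \<open>Re_add_ge\<close> minus 1. The
    last term is the function 8 t^3 / (1 - t^2), up to the factor 1 - \<alpha>, from which the error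
    term there was built.\<close>
  define E where "E t = - 2 * \<alpha> * ln (1 + t) - 4 * (1 - \<alpha>) * t / (1 + t) - 8 * (1 - \<alpha>) * t ^ 3 / (1 - t\<^sup>2)"
    for t
  define E' where "E' t = - 2 * \<alpha> / (1 + t) - 4 * (1 - \<alpha>) / (1 + t)\<^sup>2
      - (1 - \<alpha>) * (24 * t\<^sup>2 - 8 * t ^ 4) / (1 - t\<^sup>2)\<^sup>2" for t
  have "(E has_real_derivative E' t) (at t)" if t: "0 \<le> t" "t < 1" for t
  proof -
    have nz: "1 + t \<noteq> 0" "1 - t\<^sup>2 \<noteq> 0" using t by (auto simp: power2_eq_1_iff)
    have 1: "((\<lambda>t. t / (1 + t)) has_real_derivative 1 / (1 + t)\<^sup>2) (at t)"
      using nz by (auto intro!: derivative_eq_intros simp: power2_eq_square)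
    have 2: "((\<lambda>t. t ^ 3 / (1 - t\<^sup>2)) has_real_derivative (3 * t\<^sup>2 - t ^ 4) / (1 - t\<^sup>2)\<^sup>2) (at t)"
      using nz by (auto intro!: derivative_eq_intros simp: power2_eq_square)
        (simp add: algebra_simps power2_eq_square power3_eq_cube power4_eq_xxxx)
    have 3: "((\<lambda>t. ln (1 + t)) has_real_derivative 1 / (1 + t)) (at t)"
      using t by (auto intro!: derivative_eq_intros)
    have "E = (\<lambda>t. (- 2 * \<alpha>) * ln (1 + t) - (4 * (1 - \<alpha>)) * (t / (1 + t)) - (8 * (1 - \<alpha>)) * (t ^ 3 / (1 - t\<^sup>2)))"
      by (simp add: E_def fun_eq_iff)
    moreover have "((\<lambda>t. (- 2 * \<alpha>) * ln (1 + t) - (4 * (1 - \<alpha>)) * (t / (1 + t)) - (8 * (1 - \<alpha>)) * (t ^ 3 / (1 - t\<^sup>2)))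
       has_real_derivative (- 2 * \<alpha>) * (1 / (1 + t)) - (4 * (1 - \<alpha>)) * (1 / (1 + t)\<^sup>2)
          - (8 * (1 - \<alpha>)) * ((3 * t\<^sup>2 - t ^ 4) / (1 - t\<^sup>2)\<^sup>2)) (at t)"
      by (intro DERIV_diff DERIV_cmult 1 2 3)
    moreover have "(- 2 * \<alpha>) * (1 / (1 + t)) - (4 * (1 - \<alpha>)) * (1 / (1 + t)\<^sup>2)
          - (8 * (1 - \<alpha>)) * ((3 * t\<^sup>2 - t ^ 4) / (1 - t\<^sup>2)\<^sup>2) = E' t"
    proof -
      have "(8 * (1 - \<alpha>)) * (3 * t\<^sup>2 - t ^ 4) = (1 - \<alpha>) * (24 * t\<^sup>2 - 8 * t ^ 4)"
        by (simp add: algebra_simps)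
      then show ?thesis by (simp add: E'_def)
    qed
    ultimately show ?thesis by metis
  qed
  moreover have "cmod v * E' (cmod v) \<le> Re (v * deriv ?V v)" if v: "v \<in> ball 0 1" for v
  proof -
    define s where "s = cmod v"
    have s: "0 \<le> s" "s < 1" using v by (auto simp: s_def)
    have "s * E' s = \<alpha> * ((1 - s) / (1 + s)) +
           (1 - \<alpha>) * (((1 - s) / (1 + s))\<^sup>2 - (24 * s ^ 3 - 8 * s ^ 5) / (1 - s\<^sup>2)\<^sup>2) - 1"
    proof -
      \<comment> \<open>Keeping the denominators abstract leaves only a linear identity; the
        concrete fractions are matched afterwards.\<close>
      have "s * (- 2 * \<alpha> / x - 4 * (1 - \<alpha>) / y - (1 - \<alpha>) * n / z)
          = \<alpha> * (1 - 2 * s / x) + (1 - \<alpha>) * ((1 - 4 * s / y) - (s * n) / z) - 1" for x y z n :: real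
        by (simp add: divide_inverse algebra_simps)
      moreover have "(1 - s) / (1 + s) = 1 - 2 * s / (1 + s)" using s by (simp add: field_simps)
      moreover have "((1 - s) / (1 + s))\<^sup>2 = 1 - 4 * s / (1 + s)\<^sup>2"
        using s by (simp add: power_divide divide_simps) (simp add: power2_eq_square algebra_simps)
      moreover have "24 * s ^ 3 - 8 * s ^ 5 = s * (24 * s\<^sup>2 - 8 * s ^ 4)"
        by (simp add: algebra_simps eval_nat_numeral)
      ultimately show ?thesis unfolding E'_def by metis
    qed
    then show ?thesis using Re_add_ge[OF v s_def] unfolding vV[OF v] s_def[symmetric] by linarith
  qed
  ultimately have "E (cmod w) - E 0 \<le> Re (?V w - ?V 0)"
    by (rule Re_radial_growth[OF holV w])
  then show ?L by (simp add: E_def t W0)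
  \<comment> \<open>The upper bound is the growth lemma applied to the negative, so \<open>F\<close>
    is minus the desired bound.\<close>
  let ?N = "\<lambda>v. - (of_real \<kappa> * W v)"
  have holU: "?N holomorphic_on ball 0 1" by (intro holomorphic_intros hol)
  have vU: "Re (v * deriv ?N v) = 1 - Re (A v + B v)" if "v \<in> ball 0 1" for v
    using vV[OF that] holomorphic_on_imp_differentiable_at[OF holV open_ball that] by simp
  define F where "F t = 2 * \<alpha> * ln (1 - t) - 4 * (1 - \<alpha>) * (t / (1 - t))" for t
  define F' where "F' t = - 2 * \<alpha> / (1 - t) - 4 * (1 - \<alpha>) / (1 - t)\<^sup>2" for t
  have "(F has_real_derivative F' t) (at t)" if t: "0 \<le> t" "t < 1" for t
  proof -
    have 1: "((\<lambda>t. t / (1 - t)) has_real_derivative 1 / (1 - t)\<^sup>2) (at t)"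
      using t by (auto intro!: derivative_eq_intros simp: power2_eq_square)
    have 3: "((\<lambda>t. ln (1 - t)) has_real_derivative - 1 / (1 - t)) (at t)"
      using t by (auto intro!: derivative_eq_intros)
    have "(F has_real_derivative 2 * \<alpha> * (- 1 / (1 - t)) - 4 * (1 - \<alpha>) * (1 / (1 - t)\<^sup>2)) (at t)"
      unfolding F_def[abs_def] by (intro DERIV_diff DERIV_cmult 1 3)
    then show ?thesis by (simp add: F'_def)
  qed
  moreover have "cmod v * F' (cmod v) \<le> Re (v * deriv ?N v)" if v: "v \<in> ball 0 1" for v
  proof -
    define s where "s = cmod v"
    have s: "0 \<le> s" "s < 1" using v by (auto simp: s_def)
    have "s * F' s = 1 - (\<alpha> * ((1 + s) / (1 - s)) + (1 - \<alpha>) * ((1 + s) / (1 - s))\<^sup>2)"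
    proof -
      have "s * (- 2 * \<alpha> / x - 4 * (1 - \<alpha>) / y)
          = 1 - (\<alpha> * (1 + 2 * s / x) + (1 - \<alpha>) * (1 + 4 * s / y))" for x y :: real
        by (simp add: divide_inverse algebra_simps)
      moreover have "(1 + s) / (1 - s) = 1 + 2 * s / (1 - s)" using s by (simp add: field_simps)
      moreover have "((1 + s) / (1 - s))\<^sup>2 = 1 + 4 * s / (1 - s)\<^sup>2"
        using s by (simp add: power_divide divide_simps) (simp add: power2_eq_square algebra_simps)
      ultimately show ?thesis unfolding F'_def by metis
    qed
    then show ?thesis using Re_add_le[OF v s_def] unfolding vU[OF v] s_def[symmetric] by linarith
  qed
  ultimately have "F (cmod w) - F 0 \<le> Re (?N w - ?N 0)"
    by (rule Re_radial_growth[OF holU w])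
  then show ?U by (simp add: F_def t W0)
qed

end

section \<open>Pointwise bounds for the area density\<close>

text \<open>The exponent is 2 + 2 \<alpha> / \<kappa>, so its double splits off the integer power
  x^4 and leaves a pure exponential.\<close>

lemma power2_divide_powr:
  fixes x \<kappa> \<alpha> N :: real
  assumes "x > 0" "\<kappa> > 0"
  shows "(N / x powr (2 * (\<alpha> + \<kappa>) / \<kappa>))\<^sup>2 = (N / x)\<^sup>2 / x\<^sup>2 * exp (- (4 * \<alpha> / \<kappa>) * ln x)"
proof -
  have "2 * (\<alpha> + \<kappa>) / \<kappa> + 2 * (\<alpha> + \<kappa>) / \<kappa> = 4 + 4 * \<alpha> / \<kappa>"
    using assms by (simp add: add_divide_distrib distrib_left)
  then have "(x powr (2 * (\<alpha> + \<kappa>) / \<kappa>))\<^sup>2 = x powr (4 + 4 * \<alpha> / \<kappa>)"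
    by (simp only: power2_eq_square powr_add[symmetric])
  also have "\<dots> = x ^ 4 * exp ((4 * \<alpha> / \<kappa>) * ln x)"
    using assms by (simp add: powr_add powr_realpow[of x 4, simplified]) (simp add: powr_def)
  finally show ?thesis
    unfolding power_divide mult_minus_left exp_minus
    by (simp only:) (simp add: divide_inverse eval_nat_numeral)
qed

text \<open>Because \<open>F \<ge> exp y * G\<close> with \<open>y = 16 (1 - \<alpha>) t / (\<kappa> (1 - t\<^sup>2))\<close>, replacing
  \<open>(1 - t\<^sup>2) * G\<close> by \<open>G - t\<^sup>2 * F\<close> loses so much that an additional factor
  \<open>exp (- t\<^sup>2 * y)\<close>, which is the effect of the cubic term in the bound for V, is harmless.\<close>

lemma area_density_bounds:
  fixes \<alpha> \<kappa> t V D :: real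
  assumes \<alpha>: "0 \<le> \<alpha>" "\<alpha> < 1" and \<kappa>: "\<kappa> > 0" and t: "0 \<le> t" "t < 1"
    and Vl: "- 2 * \<alpha> * ln (1 + t) - 4 * (1 - \<alpha>) * t / (1 + t) - 8 * (1 - \<alpha>) * t ^ 3 / (1 - t\<^sup>2) \<le> \<kappa> * V"
    and Vu: "\<kappa> * V \<le> - 2 * \<alpha> * ln (1 - t) + 4 * (1 - \<alpha>) * t / (1 - t)"
    and Dl: "((1 - (1 - 2 * \<alpha>) * t) / (1 + t))\<^sup>2 * ((1 - t) / (1 + t)) \<le> D"
    and Du: "D \<le> ((1 + (1 - 2 * \<alpha>) * t) / (1 - t))\<^sup>2 * ((1 + t) / (1 - t))"
  defines "F \<equiv> ((1 + (1 - 2 * \<alpha>) * t) / (1 - t) powr (2 * (\<alpha> + \<kappa>) / \<kappa>))\<^sup>2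
                 * exp (8 * (1 - \<alpha>) * t / (\<kappa> * (1 - t)))"
    and "G \<equiv> ((1 - (1 - 2 * \<alpha>) * t) / (1 + t) powr (2 * (\<alpha> + \<kappa>) / \<kappa>))\<^sup>2
                 * exp (- 8 * (1 - \<alpha>) * t / (\<kappa> * (1 + t)))"
  shows "G - t\<^sup>2 * F \<le> exp (2 * V) * D" and "exp (2 * V) * D \<le> F - t\<^sup>2 * G"
proof -
  define P where "P = (1 + (1 - 2 * \<alpha>) * t) / (1 - t)"
  define Q where "Q = (1 - (1 - 2 * \<alpha>) * t) / (1 + t)"
  \<comment> \<open>The exponents for which F = P^2 / (1 - t)^2 exp U and G = Q^2 / (1 + t)^2 exp
    L.\<close>
  define U where "U = - (4 * \<alpha> / \<kappa>) * ln (1 - t) + 8 * (1 - \<alpha>) * t / (\<kappa> * (1 - t))"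
  define L where "L = - (4 * \<alpha> / \<kappa>) * ln (1 + t) + - 8 * (1 - \<alpha>) * t / (\<kappa> * (1 + t))"
  have L': "L = - (4 * \<alpha> / \<kappa>) * ln (1 + t) - 8 * (1 - \<alpha>) * t / (\<kappa> * (1 + t))"
    by (simp only: L_def mult_minus_left minus_divide_left[symmetric] diff_conv_add_uminus)
  \<comment> \<open>This is U - L without the logarithms, as t / (1 - t) + t / (1 + t) = 2 t / (1 -
    t^2). The logarithms only increase U - L.\<close>
  define y where "y = 16 * (1 - \<alpha>) * t / (\<kappa> * (1 - t\<^sup>2))"
  have t2: "1 - t\<^sup>2 > 0" "t\<^sup>2 \<ge> 0" using t by (simp_all add: abs_square_less_1)
  have y0: "0 \<le> y" using \<alpha> t t2 \<kappa> by (simp add: y_def)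
  have F: "F = P\<^sup>2 / (1 - t)\<^sup>2 * exp U"
    unfolding F_def P_def U_def exp_add
    by (subst power2_divide_powr) (use t \<kappa> in \<open>simp_all only: mult.assoc diff_gt_0_iff_gt\<close>)
  have G: "G = Q\<^sup>2 / (1 + t)\<^sup>2 * exp L"
    unfolding G_def Q_def L_def exp_add
    by (subst power2_divide_powr) (use t \<kappa> in \<open>simp_all only: mult.assoc add_pos_nonneg zero_less_one\<close>)
  have G0: "0 \<le> G" by (simp add: G_def)
  have Dnn: "0 \<le> D" using t by (intro order_trans[OF _ Dl]) simp
  have "t / (1 - t) = 2 * t / (1 - t\<^sup>2) - t / (1 + t)"
    using t t2 by (simp add: divide_simps) (simp add: power2_eq_square algebra_simps)
  then have "(8 * (1 - \<alpha>) / \<kappa>) * (t / (1 - t))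
       = (8 * (1 - \<alpha>) / \<kappa>) * (2 * t / (1 - t\<^sup>2)) - (8 * (1 - \<alpha>) / \<kappa>) * (t / (1 + t))"
    by (simp only: right_diff_distrib)
  then have "8 * (1 - \<alpha>) * t / (\<kappa> * (1 - t)) = y - 8 * (1 - \<alpha>) * t / (\<kappa> * (1 + t))"
    by (simp add: y_def)
  moreover have "(4 * \<alpha> / \<kappa>) * ln (1 - t) \<le> 0"
    using t \<alpha> \<kappa> by (intro mult_nonneg_nonpos) auto
  moreover have "(4 * \<alpha> / \<kappa>) * ln (1 + t) \<ge> 0" using t \<alpha> \<kappa> by simp
  ultimately have UL: "y + L \<le> U" unfolding U_def L' by linarith
  have nn: "0 \<le> 1 - (1 - 2 * \<alpha>) * t"
    using mult_right_mono[of "1 - 2 * \<alpha>" 1 t] \<alpha> t by simp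
  have FG: "exp y * G \<le> F"
  proof -
    have "Q\<^sup>2 / (1 + t)\<^sup>2 \<le> P\<^sup>2 / (1 - t)\<^sup>2"
    proof -
      have "Q \<le> P"
        unfolding Q_def P_def using t \<alpha>
        by (simp add: divide_simps) (simp add: algebra_simps mult_left_le_one_le)
      moreover have "0 \<le> Q" using nn t by (simp add: Q_def)
      ultimately show ?thesis using t by (intro frac_le power_mono) auto
    qed
    then have "Q\<^sup>2 / (1 + t)\<^sup>2 * exp (y + L) \<le> P\<^sup>2 / (1 - t)\<^sup>2 * exp U"
      using UL by (intro mult_mono) auto
    then show ?thesis by (simp add: F G exp_add mult_ac)
  qed
  have "G \<le> exp y * G" using y0 G0 by (simp add: mult_le_cancel_right1)
  with FG have "G \<le> F" by linarith
  have "2 * V \<le> U"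
  proof -
    have "(2 / \<kappa>) * (\<kappa> * V) \<le> (2 / \<kappa>) * (- 2 * \<alpha> * ln (1 - t) + 4 * (1 - \<alpha>) * t / (1 - t))"
      using \<kappa> by (intro mult_left_mono Vu) auto
    moreover have "(2 / \<kappa>) * (- 2 * \<alpha> * l + 4 * (1 - \<alpha>) * t / m)
        = - (4 * \<alpha> / \<kappa>) * l + 8 * (1 - \<alpha>) * t / (\<kappa> * m)" for l m
      by (simp add: divide_inverse algebra_simps)
    ultimately have "(2 / \<kappa>) * (\<kappa> * V) \<le> U" unfolding U_def by metis
    then show ?thesis using \<kappa> by simp
  qed
  \<comment> \<open>The product of the two upper bounds is (1 - t^2) F, and \<open>G \<le> F\<close>
    allows t^2 F to be replaced by t^2 G.\<close>
  then have "exp (2 * V) * D \<le> exp U * (P\<^sup>2 * ((1 + t) / (1 - t)))"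
    using Du Dnn by (intro mult_mono) (auto simp: P_def)
  also have "\<dots> = F * (1 - t\<^sup>2)"
  proof -
    have "(1 + t) / (1 - t) = (1 - t\<^sup>2) / (1 - t)\<^sup>2"
      using t by (simp add: divide_simps) (simp add: power2_eq_square algebra_simps)
    then show ?thesis by (simp add: F)
  qed
  also have "\<dots> \<le> F - t\<^sup>2 * G"
    using mult_left_mono[OF \<open>G \<le> F\<close> t2(2)] by (simp add: algebra_simps)
  finally show "exp (2 * V) * D \<le> F - t\<^sup>2 * G" .
  have L2V: "L - t\<^sup>2 * y \<le> 2 * V"
  proof -
    have "(2 / \<kappa>) * (- 2 * \<alpha> * ln (1 + t) - 4 * (1 - \<alpha>) * t / (1 + t) - 8 * (1 - \<alpha>) * t ^ 3 / (1 - t\<^sup>2))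
        \<le> (2 / \<kappa>) * (\<kappa> * V)"
      using \<kappa> by (intro mult_left_mono Vl) auto
    moreover have "(2 / \<kappa>) * (- 2 * \<alpha> * l - 4 * (1 - \<alpha>) * t / m - X)
        = - (4 * \<alpha> / \<kappa>) * l - 8 * (1 - \<alpha>) * t / (\<kappa> * m) - (2 / \<kappa>) * X" for l m X
      by (simp add: divide_inverse algebra_simps)
    moreover have "t\<^sup>2 * y = (2 / \<kappa>) * (8 * (1 - \<alpha>) * t ^ 3 / (1 - t\<^sup>2))"
      by (simp add: y_def power2_eq_square power3_eq_cube)
    ultimately have "L - t\<^sup>2 * y \<le> (2 / \<kappa>) * (\<kappa> * V)" unfolding L' by metis
    then show ?thesis using \<kappa> by simp
  qed
  \<comment> \<open>Both exponentials are estimated by their tangents. The intermediate value 1 -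
    t^2 - t^2 y is below (1 - t^2) (1 - t^2 y), the difference being t^4 y.\<close>
  have "1 - t\<^sup>2 * exp y \<le> (1 - t\<^sup>2) * exp (- (t\<^sup>2 * y))"
  proof -
    have "t\<^sup>2 * (1 + y) \<le> t\<^sup>2 * exp y"
      using t2 by (intro mult_left_mono exp_ge_add_one_self) auto
    then have "1 - t\<^sup>2 * exp y \<le> 1 - t\<^sup>2 - t\<^sup>2 * y" by (simp add: algebra_simps)
    also have "\<dots> \<le> (1 - t\<^sup>2) * (1 + - (t\<^sup>2 * y))"
      using y0 t2 by (simp add: algebra_simps)
    also have "\<dots> \<le> (1 - t\<^sup>2) * exp (- (t\<^sup>2 * y))"
      using t2 by (intro mult_left_mono exp_ge_add_one_self) auto
    finally show ?thesis .
  qed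
  then have "G * (1 - t\<^sup>2 * exp y) \<le> G * ((1 - t\<^sup>2) * exp (- (t\<^sup>2 * y)))"
    using G0 by (rule mult_left_mono)
  moreover have "t\<^sup>2 * (exp y * G) \<le> t\<^sup>2 * F" using FG t2(2) by (rule mult_left_mono)
  ultimately have "G - t\<^sup>2 * F \<le> G * ((1 - t\<^sup>2) * exp (- (t\<^sup>2 * y)))"
    by (simp add: algebra_simps)
  also have "\<dots> = exp (L - t\<^sup>2 * y) * (Q\<^sup>2 * ((1 - t) / (1 + t)))"
  proof -
    have "(1 - t) / (1 + t) = (1 - t\<^sup>2) / (1 + t)\<^sup>2"
      using t by (simp add: divide_simps) (simp add: power2_eq_square algebra_simps)
    then show ?thesis by (simp add: G exp_diff exp_minus divide_inverse)
  qed
  also have "\<dots> \<le> exp (2 * V) * D"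
    using L2V Dl t by (intro mult_mono) (auto simp: Q_def)
  finally show "G - t\<^sup>2 * F \<le> exp (2 * V) * D" .
qed

section \<open>Logarithms of the analytic factors\<close>

text \<open>Only exponents n k occur, so the exponent of \<open>h\<close> is a power series in w =
  z^k.\<close>

lemma exp_gap_series_log:
  assumes "exp_gap_series k a h" "k \<ge> 1"
  obtains W where "W holomorphic_on ball 0 1" "W 0 = 0"
    "\<And>z. z \<in> ball 0 1 \<Longrightarrow> h z = exp (W (z ^ k))"
proof
  \<comment> \<open>Setting the missing constant coefficient to 0 yields W 0 = 0.\<close>
  define c where "c n = (if n = 0 then 0 else a (n * k))" for n
  define W where "W w = (\<Sum>n. c n * w ^ n)" for w
  have c: "c (Suc n) * (z ^ k) ^ Suc n = a (Suc n * k) * z ^ (Suc n * k)" for n z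
    by (simp add: c_def power_mult[symmetric] mult.commute del: mult_Suc power_Suc)
  have s: "summable (\<lambda>n. c n * (z ^ k) ^ n)" if "z \<in> ball 0 1" for z
  proof -
    have "summable (\<lambda>n. c (Suc n) * (z ^ k) ^ Suc n)"
      using assms(1) that unfolding c exp_gap_series_def by blast
    then show ?thesis by (subst (asm) summable_Suc_iff)
  qed
  show "h z = exp (W (z ^ k))" if "z \<in> ball 0 1" for z
  proof -
    have "W (z ^ k) = (\<Sum>n. c (Suc n) * (z ^ k) ^ Suc n)"
      using suminf_split_head[OF s[OF that]] by (simp add: W_def c_def)
    also have "\<dots> = (\<Sum>n. a (Suc n * k) * z ^ (Suc n * k))" by (simp only: c)
    finally show ?thesis using assms(1) that by (simp add: exp_gap_series_def del: mult_Suc)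
  qed
  show "W holomorphic_on ball 0 1"
  proof (rule power_series_holomorphic)
    fix w :: complex assume w: "w \<in> ball 0 1"
    \<comment> \<open>Every w in the disc is the k-th power of some z in the disc, so convergence in
      z gives convergence at every w.\<close>
    obtain z where z: "z ^ k = w" using exists_complex_root[of k w] assms(2) by auto
    have "cmod z ^ k < 1" using w by (simp flip: z norm_power)
    then have "z \<in> ball 0 1" using assms(2) by (simp add: power_less_one_iff)
    from s[OF this] show "(\<lambda>n. c n * (w - 0) ^ n) sums W w"
      by (simp add: z W_def summable_sums)
  qed
  show "W 0 = 0" by (simp add: W_def c_def powser_zero)
qed

subsection \<open>Starlike logharmonic mappings\<close>

text \<open>The derivative takes the values a + b at 1 and i (a - b) at i; the two Wirtinger
  combinations solve for \<open>a\<close> and \<open>b\<close>.\<close>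

lemma frechet_derivative_wirtinger:
  assumes "(f has_derivative (\<lambda>w. a * w + b * cnj w)) (at z)"
  shows "wirtinger_dz f z = a" "wirtinger_dzbar f z = b"
  using frechet_derivative_at[OF assms, symmetric]
  by (simp_all add: wirtinger_dz_def wirtinger_dzbar_def algebra_simps)

lemma has_derivative_mult_cnj:
  assumes "(u has_field_derivative u') (at z)" "(v has_field_derivative v') (at z)"
  shows "((\<lambda>z. u z * cnj (v z)) has_derivative (\<lambda>w. u' * cnj (v z) * w + u z * cnj v' * cnj w)) (at z)"
proof -
  have "(u has_derivative (\<lambda>w. u' * w)) (at z)" "(v has_derivative (\<lambda>w. v' * w)) (at z)"
    using assms by (simp_all add: has_field_derivative_def)
  from has_derivative_mult[OF this(1) bounded_linear.has_derivative[OF bounded_linear_cnj this(2)]]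
  show ?thesis by (simp add: algebra_simps)
qed

theorem theorem5:
  fixes k :: nat and \<alpha> r :: real and f :: "complex \<Rightarrow> complex"
  assumes "k \<ge> 1"
    and "0 \<le> \<alpha>" and "\<alpha> < 1"
    and "0 < r" and "r < 1"
    and "f \<in> S_LH_star k \<alpha>"
  shows "2 * pi * L1 k \<alpha> r \<le> measure lebesgue (f ` ball 0 r) \<and>
         measure lebesgue (f ` ball 0 r) \<le> 2 * pi * L2 k \<alpha> r"
proof -
  from assms(6) obtain h g a b \<omega> where inj: "inj_on f (ball 0 1)"
    and h: "exp_gap_series k a h" and g: "exp_gap_series k b g"
    and f_hg: "\<And>z. z \<in> ball 0 1 \<Longrightarrow> f z = z * h z * cnj (g z)"
    and star: "starlike_of_order \<alpha> f" and dil: "second_dilatation f \<omega>"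
    by (auto simp: S_LH_star_def logharmonic_def)
  obtain Wa where Wa: "Wa holomorphic_on ball 0 1" "Wa 0 = 0"
    "\<And>z. z \<in> ball 0 1 \<Longrightarrow> h z = exp (Wa (z ^ k))"
    using exp_gap_series_log[OF h assms(1)] by blast
  obtain Wb where Wb: "Wb holomorphic_on ball 0 1" "Wb 0 = 0"
    "\<And>z. z \<in> ball 0 1 \<Longrightarrow> g z = exp (Wb (z ^ k))"
    using exp_gap_series_log[OF g assms(1)] by blast
  \<comment> \<open>For h = exp (Wa (z^k)) the chain rule gives z h'/h = k w Wa'(w) at w = z^k, and
    likewise for \<open>g\<close>.\<close>
  define A where "A w = 1 + of_nat k * w * deriv Wa w" for w
  define B where "B w = of_nat k * w * deriv Wb w" for w
  define W where "W w = Wa w + Wb w" for w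
  \<comment> \<open>On the disc f is \<open>u * cnj v\<close> with both factors analytic, so its
    Wirtinger derivatives are u' times the conjugate of v, and u times the conjugate of v'.\<close>
  define u where "u z = z * exp (Wa (z ^ k))" for z
  define v where "v z = exp (Wb (z ^ k))" for z
  define v' where "v' z = exp (Wb (z ^ k)) * (deriv Wb (z ^ k) * (of_nat k * z ^ (k - 1)))" for z
  define fz where "fz z = exp (Wa (z ^ k)) * A (z ^ k) * cnj (v z)" for z
  define fzb where "fzb z = u z * cnj (v' z)" for z
  have zk: "z * z ^ (k - 1) = z ^ k" for z :: complex
    using assms(1) by (cases k) auto
  have ball: "z ^ k \<in> ball 0 1" if "z \<in> ball 0 1" for z :: complex
    using that assms(1) by (simp add: norm_power power_less_one_iff)
  have f_uv: "f z = u z * cnj (v z)" if "z \<in> ball 0 1" for z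
    using f_hg[OF that] Wa(3)[OF that] Wb(3)[OF that] by (simp add: u_def v_def)
  have der: "(f has_derivative (\<lambda>w. fz z * w + fzb z * cnj w)) (at z)" if z: "z \<in> ball 0 1" for z
  proof -
    have da: "((\<lambda>z. Wa (z ^ k)) has_field_derivative deriv Wa (z ^ k) * (of_nat k * z ^ (k - 1))) (at z)"
      by (rule DERIV_chain2[where g = "\<lambda>z. z ^ k", OF holomorphic_derivI[OF Wa(1) open_ball ball[OF z]]])
         (auto intro!: derivative_eq_intros)
    have db: "((\<lambda>z. Wb (z ^ k)) has_field_derivative deriv Wb (z ^ k) * (of_nat k * z ^ (k - 1))) (at z)"
      by (rule DERIV_chain2[where g = "\<lambda>z. z ^ k", OF holomorphic_derivI[OF Wb(1) open_ball ball[OF z]]])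
         (auto intro!: derivative_eq_intros)
    have "(u has_field_derivative exp (Wa (z ^ k)) * A (z ^ k)) (at z)"
    proof -
      have "(u has_field_derivative
          1 * exp (Wa (z ^ k)) + exp (Wa (z ^ k)) * (deriv Wa (z ^ k) * (of_nat k * z ^ (k - 1))) * z) (at z)"
        unfolding u_def[abs_def] by (intro DERIV_mult DERIV_ident DERIV_chain2[where f = exp, OF DERIV_exp da])
      moreover have "A (z ^ k) = 1 + of_nat k * (z * z ^ (k - 1)) * deriv Wa (z ^ k)"
        by (simp only: A_def zk)
      ultimately show ?thesis by (simp add: algebra_simps)
    qed
    moreover have "(v has_field_derivative v' z) (at z)"
      unfolding v_def[abs_def] v'_def by (rule DERIV_chain2[where f = exp, OF DERIV_exp db])
    ultimately have "((\<lambda>z. u z * cnj (v z)) has_derivative (\<lambda>w. fz z * w + fzb z * cnj w)) (at z)"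
      unfolding fz_def fzb_def by (rule has_derivative_mult_cnj)
    then show ?thesis
      by (rule has_derivative_transform_within_open[OF _ open_ball z]) (simp add: f_uv)
  qed
  have fz: "wirtinger_dz f z = fz z" and fzb: "wirtinger_dzbar f z = fzb z" if "z \<in> ball 0 1" for z
    using frechet_derivative_wirtinger[OF der[OF that]] by auto
  have zfz: "z * fz z = f z * A (z ^ k)" if "z \<in> ball 0 1" for z
    by (simp add: fz_def f_uv[OF that] u_def)
  have zfzb: "cnj z * fzb z = f z * cnj (B (z ^ k))" if "z \<in> ball 0 1" for z
  proof -
    have "cnj z * cnj (v' z) = cnj (v z) * cnj (B (z ^ k))"
      unfolding v'_def v_def B_def zk[symmetric] by simp
    then show ?thesis by (simp add: fzb_def f_uv[OF that])
  qed
  have f0: "f z \<noteq> 0" if "z \<in> ball 0 1" "z \<noteq> 0" for z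
    using that by (simp add: f_uv u_def v_def)
  \<comment> \<open>Conditions known at z are transferred to w = z^k through a root; z \<noteq> 0
    keeps f z away from 0.\<close>
  have root: "\<exists>z. z \<in> ball 0 1 \<and> z \<noteq> 0 \<and> z ^ k = w" if w: "w \<in> ball 0 1" "w \<noteq> 0" for w :: complex
  proof -
    obtain z where z: "z ^ k = w" using exists_complex_root[of k w] assms(1) by auto
    have "cmod z ^ k < 1" using w by (simp flip: z norm_power)
    then have "z \<in> ball 0 1" using assms(1) by (simp add: power_less_one_iff)
    then show ?thesis using z w assms(1) by auto
  qed
  have Re_AB: "\<alpha> < Re (A w - B w)" if w: "w \<in> ball 0 1" for w
  proof (cases "w = 0")
    case False
    then obtain z where z: "z \<in> ball 0 1" "z \<noteq> 0" "z ^ k = w" using root w by blast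
    \<comment> \<open>Conjugating B does not change the real part, so the condition passes to the
      analytic function A - B.\<close>
    have "starlike_quotient f z = A w - cnj (B w)"
      using f0[OF z(1,2)] z
      by (simp add: starlike_quotient_def fz fzb zfz zfzb flip: right_diff_distrib)
    then show ?thesis using star z by (force simp: starlike_of_order_def)
  qed (use assms in \<open>simp add: A_def B_def\<close>)
  have B_less: "cmod (B w) < cmod (A w)" if w: "w \<in> ball 0 1" for w
  proof (cases "w = 0")
    case False
    then obtain z where z: "z \<in> ball 0 1" "z \<noteq> 0" "z ^ k = w" using root w by blast
    \<comment> \<open>Multiplied by z, the dilatation equation becomes B w = \<omega>(z) A w. Strict
      inequality needs A w \<noteq> 0: otherwise B w would vanish too, against Re (A - B) > \<alpha>
      \<ge> 0.\<close>
    have "cnj (fzb z) / cnj (f z) = \<omega> z * (fz z / f z)"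
      using dil z f0 fz fzb by (simp add: second_dilatation_def)
    then have "z * (cnj (fzb z) / cnj (f z)) = \<omega> z * (z * fz z / f z)" by simp
    moreover have "z * (cnj (fzb z) / cnj (f z)) = B w"
      using arg_cong[OF zfzb[OF z(1)], of cnj] f0[OF z(1,2)] z(3) by simp
    moreover have "z * fz z / f z = A w" using f0 z by (simp add: zfz)
    ultimately have BA: "B w = \<omega> z * A w" by simp
    then have "A w \<noteq> 0" using Re_AB[OF w] assms(2) by auto
    moreover have "cmod (\<omega> z) < 1" using dil z by (simp add: second_dilatation_def)
    ultimately show ?thesis by (simp add: BA norm_mult)
  qed (simp add: A_def B_def)
  interpret starlike_pair \<alpha> A B
  proof
    show "A holomorphic_on ball 0 1" "B holomorphic_on ball 0 1"
      unfolding A_def[abs_def] B_def[abs_def]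
      by (intro holomorphic_intros holomorphic_deriv Wa Wb open_ball)+
  qed (use assms Re_AB B_less in \<open>auto simp: A_def B_def\<close>)
  have holW: "W holomorphic_on ball 0 1"
    unfolding W_def[abs_def] by (intro holomorphic_intros Wa Wb)
  have W': "of_real (real k) * w * deriv W w = A w + B w - 1" if "w \<in> ball 0 1" for w
  proof -
    have "deriv W w = deriv Wa w + deriv Wb w"
      unfolding W_def[abs_def]
      using holomorphic_on_imp_differentiable_at[OF Wa(1) open_ball that]
        holomorphic_on_imp_differentiable_at[OF Wb(1) open_ball that] by (rule deriv_add)
    then show ?thesis by (simp add: A_def B_def algebra_simps)
  qed
  have J: "(cmod (fz z))\<^sup>2 - (cmod (fzb z))\<^sup>2
      = exp (2 * Re (W (z ^ k))) * ((cmod (A (z ^ k)))\<^sup>2 - (cmod (B (z ^ k)))\<^sup>2)" for z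
  proof -
    have e: "exp (2 * Re (W (z ^ k))) = (exp (Re (Wa (z ^ k))) * exp (Re (Wb (z ^ k))))\<^sup>2"
      by (simp only: W_def plus_complex.sel exp_double exp_add)
    have "cmod (fz z) = exp (Re (Wa (z ^ k))) * exp (Re (Wb (z ^ k))) * cmod (A (z ^ k))"
      by (simp add: fz_def v_def norm_mult)
    moreover have "cmod (fzb z) = exp (Re (Wa (z ^ k))) * exp (Re (Wb (z ^ k))) * cmod (B (z ^ k))"
    proof -
      \<comment> \<open>The factor z of \<open>u\<close> is attached to \<open>v'\<close>, which
        produces B without dividing by z.\<close>
      have "z * v' z = v z * B (z ^ k)"
        unfolding v'_def v_def B_def zk[symmetric] by simp
      moreover have "cmod (fzb z) = cmod (exp (Wa (z ^ k)) * (z * v' z))"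
        by (simp add: fzb_def u_def norm_mult)
      ultimately show ?thesis by (simp add: norm_mult v_def)
    qed
    ultimately show ?thesis
      unfolding e by (simp add: power_mult_distrib algebra_simps)
  qed
  \<comment> \<open>The weights of \<open>L2\<close> and \<open>L1\<close> at t = \<rho>^k. The
    square of \<rho>^k in the subtracted integrals is the t^2 of the pointwise bounds.\<close>
  define F where "F \<rho> = ((1 + (1 - 2 * \<alpha>) * \<rho> ^ k) / (1 - \<rho> ^ k) powr (2 * (\<alpha> + real k) / real k))\<^sup>2
       * exp (8 * (1 - \<alpha>) * \<rho> ^ k / (real k * (1 - \<rho> ^ k)))" for \<rho> :: real
  define G where "G \<rho> = ((1 - (1 - 2 * \<alpha>) * \<rho> ^ k) / (1 + \<rho> ^ k) powr (2 * (\<alpha> + real k) / real k))\<^sup>2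
       * exp (- 8 * (1 - \<alpha>) * \<rho> ^ k / (real k * (1 + \<rho> ^ k)))" for \<rho> :: real
  have bounds: "G (cmod z) - (cmod z ^ k)\<^sup>2 * F (cmod z) \<le> (cmod (fz z))\<^sup>2 - (cmod (fzb z))\<^sup>2"
    "(cmod (fz z))\<^sup>2 - (cmod (fzb z))\<^sup>2 \<le> F (cmod z) - (cmod z ^ k)\<^sup>2 * G (cmod z)"
    "0 \<le> (cmod (fz z))\<^sup>2 - (cmod (fzb z))\<^sup>2"
    if z: "z \<in> ball 0 1" for z
  proof -
    have t: "cmod z ^ k = cmod (z ^ k)" by (simp add: norm_power)
    have t01: "0 \<le> cmod z ^ k" "cmod z ^ k < 1" using ball[OF z] by (simp_all add: norm_power)
    have k: "0 < real k" using assms(1) by simp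
    have W0: "W 0 = 0" by (simp add: W_def Wa Wb)
    note V = Re_log_bounds[OF holW W0 k W' ball[OF z] t]
    note D = norm_diff_squares_bounds[OF ball[OF z] t]
    show "G (cmod z) - (cmod z ^ k)\<^sup>2 * F (cmod z) \<le> (cmod (fz z))\<^sup>2 - (cmod (fzb z))\<^sup>2"
      unfolding J F_def G_def by (rule area_density_bounds(1)[OF \<alpha> k t01 V D])
    show "(cmod (fz z))\<^sup>2 - (cmod (fzb z))\<^sup>2 \<le> F (cmod z) - (cmod z ^ k)\<^sup>2 * G (cmod z)"
      unfolding J F_def G_def by (rule area_density_bounds(2)[OF \<alpha> k t01 V D])
    show "0 \<le> (cmod (fz z))\<^sup>2 - (cmod (fzb z))\<^sup>2"
      unfolding J using B_less[OF ball[OF z]] by (simp add: power_mono)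
  qed
  \<comment> \<open>As r < 1, the denominators 1 - \<rho>^k do not vanish on the closed interval, so
    the weights are continuous there.\<close>
  have pow: "\<rho> ^ k < 1" if "\<rho> \<in> {0..r}" for \<rho>
    using that assms(1,5) by (simp add: power_less_one_iff)
  have contF: "continuous_on {0..r} F"
    unfolding F_def[abs_def] using pow assms(1)
    by (intro continuous_intros) (auto simp: powr_eq_0_iff, fastforce+)
  have contG: "continuous_on {0..r} G"
    unfolding G_def[abs_def] using assms(1)
    by (intro continuous_intros) (auto simp: add_pos_nonneg add_nonneg_eq_0_iff)
  have sub: "ball 0 r \<subseteq> ball (0::complex) 1" "cball 0 r \<subseteq> ball (0::complex) 1"
    using assms(5) by auto
  have cont: "continuous_on (cball 0 r) f"
    using der sub(2) by (meson continuous_at_imp_continuous_on has_derivative_continuous subsetD)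
  have contL: "continuous_on {0..r} (\<lambda>\<rho>. G \<rho> - (\<rho> ^ k)\<^sup>2 * F \<rho>)"
    and contU: "continuous_on {0..r} (\<lambda>\<rho>. F \<rho> - (\<rho> ^ k)\<^sup>2 * G \<rho>)"
    by (intro continuous_intros contF contG)+
  have inj': "inj_on f (ball 0 r)" using inj sub(1) by (rule inj_on_subset)
  have der': "(f has_derivative (\<lambda>w. fz z * w + fzb z * cnj w)) (at z)" if "z \<in> ball 0 r" for z
    using der sub(1) that by blast
  have lo: "G (cmod z) - (cmod z ^ k)\<^sup>2 * F (cmod z) \<le> \<bar>(cmod (fz z))\<^sup>2 - (cmod (fzb z))\<^sup>2\<bar>"
    and hi: "\<bar>(cmod (fz z))\<^sup>2 - (cmod (fzb z))\<^sup>2\<bar> \<le> F (cmod z) - (cmod z ^ k)\<^sup>2 * G (cmod z)"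
    if "z \<in> ball 0 r" for z
    using bounds[of z] sub(1) that by auto
  note area = measure_image_ball_polar[OF assms(4) cont inj' der' contL contU lo hi]
  have L1: "L1 k \<alpha> r = integral {0..r} (\<lambda>\<rho>. (G \<rho> - (\<rho> ^ k)\<^sup>2 * F \<rho>) * \<rho>)"
  proof -
    have "L1 k \<alpha> r = integral {0..r} (\<lambda>\<rho>. G \<rho> * \<rho>) - integral {0..r} (\<lambda>\<rho>. (\<rho> ^ k)\<^sup>2 * F \<rho> * \<rho>)"
      by (simp add: L1_def F_def G_def power_mult_distrib mult.assoc flip: times_divide_eq_right)
    also have "\<dots> = integral {0..r} (\<lambda>\<rho>. G \<rho> * \<rho> - (\<rho> ^ k)\<^sup>2 * F \<rho> * \<rho>)"
      by (intro integral_diff[symmetric] integrable_continuous_interval continuous_intros contF contG)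
    finally show ?thesis by (simp add: left_diff_distrib)
  qed
  have L2: "L2 k \<alpha> r = integral {0..r} (\<lambda>\<rho>. (F \<rho> - (\<rho> ^ k)\<^sup>2 * G \<rho>) * \<rho>)"
  proof -
    have "L2 k \<alpha> r = integral {0..r} (\<lambda>\<rho>. F \<rho> * \<rho>) - integral {0..r} (\<lambda>\<rho>. (\<rho> ^ k)\<^sup>2 * G \<rho> * \<rho>)"
      by (simp add: L2_def F_def G_def power_mult_distrib mult.assoc flip: times_divide_eq_right)
    also have "\<dots> = integral {0..r} (\<lambda>\<rho>. F \<rho> * \<rho> - (\<rho> ^ k)\<^sup>2 * G \<rho> * \<rho>)"
      by (intro integral_diff[symmetric] integrable_continuous_interval continuous_intros contF contG)
    finally show ?thesis by (simp add: left_diff_distrib)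
  qed
  show ?thesis unfolding L1 L2 using area by blast
qed

end
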